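(* Let the mesh, invariant domain, cell average decomposition, weak Lax–Friedrichs splitting, admissibility transform $\Psi$, point operator $\mathcal D^{\mathrm{pt}}$ and conservative update be as in the context (items 1–8), where the prescribed boundary conditions supply the exterior states and boundary directional derivatives required. Let $u_h^n=((\bar u_K^n)_K,(u_\sigma^n)_\sigma)$ satisfy $\bar u_K^n\in G$ for all $K\in\mathcal T_h$ and $u_\sigma^n\in\mathring G$ for all $\sigma\in\Sigma_h$. Let $u_K^n=\mathcal R_K(u_h^n)$ be the associated reconstruction and let the limited reconstruction $\hat u_K^n=\Pi_K(u_K^n;\bar u_K^n)$ be $G$-admissible for every $K$. Define one forward Euler stage $u_h^{n+1}=((\bar u_K^{n+1})_K,(u_\sigma^{n+1})_\sigma)$ by the conservative update for $\bar u_K^{n+1}$ and, with the exact inverse of $\Psi$, by $$w_\sigma^{n+1}=\Psi(u_\sigma^n)+\Delta t\,\bigl(\mathcal D^{\mathrm{pt}}(u_h^n)\bigr)_\sigma,\qquad u_\sigma^{n+1}=\Psi^{-1}(w_\sigma^{n+1}),\qquad\sigma\in\Sigma_h .$$ If $$\Delta t\le\min_{K\in\mathcal T_h}\frac{\mu_K}{2\alpha_K^n},\qquad \alpha_K^n:=\max_{e\in\mathcal E_K}\max_{\nu=1,\dots,N_q}\tilde\alpha\bigl(\hat u_K^n(x_{e,\nu}),n_{K,e}\bigr),$$ then $\bar u_K^{n+1}\in G$ for all $K\in\mathcal T_h$ and $u_\sigma^{n+1}\in\mathring G$ for all $\sigma\in\Sigma_h$; that is, $u_h^{n+1}$ again lies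 in the hybrid admissible set (averages in $G$, point values in $\mathring G$).
   Context: (1) PDE. $\partial_tu+\sum_{i=1}^2\partial_{x_i}f_i(u)=0$, hyperbolic, $u\in\mathbb R^m$; $A_i=Df_i$; $F(u)\cdot n:=\sum_in_if_i(u)$. (2) Mesh and data. $\Omega\subseteq\mathbb R^2$ is partitioned by a conforming, uniformly shape-regular mesh $\mathcal T_h$ of open convex polygonal cells $K$ with uniformly bounded number of edges; $|K|$ is the area, $\mathcal E_K$ the edge set, $|e|$ the length of $e$, $n_{K,e}$ the outward unit normal, $K_e$ the neighbour of $K$ across $e$. $\Sigma_h$ is a finite set of nodes $\sigma$ (coordinates $x_\sigma$) on the mesh skeleton: vertices and edge midpoints; $\Sigma_K=\{\sigma:x_\sigma\in\partial K\}$. $\mathbb W_K\supseteq(\mathbb P^k(K))^m$ is a finite-dimensional space of smooth $\mathbb R^m$-valued functions on $K$. The reconstruction $u_K=\mathcal R_K(u_h)\in\mathbb W_K$ satisfies $\frac1{|K|}\int_Ku_K\,dx=\bar u_K$ and $u_K(x_\sigma)=u_\sigma$ for $\sigma\in\Sigma_K$. On each edge a quadrature rule with nodes $x_{e,\nu}\in e$, $1\le\nu\le N_q$, $x_{e,\nu}\in\{x_\sigma\}$, and weights $\omega_{e,\nu}>0$, $\sum_\nu\omega_{e,\nu}=1$, satisfies $\frac1{|e|}\int_e\varphi\,ds=\sum_\nu\omega_{e,\nu}\varphi(x_{e,\nu})$ for all $\varphi\in\mathbb W_K$. (3) Invariant domain. $\mathcal J$ is a finite index set; $\mathring G=\{u\in\mathbb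 R^m:g_j(u)>0\ \forall j\in\mathcal J\}$, $G=\overline{\mathring G}=\{u:g_j(u)\ge0\ \forall j\}$ is convex, each $g_j$ concave and $C^1$ on an open set containing $G$. $S_j=\partial G\cap\partial\{g_j\ge0\}$; for $u_j^*\in S_j$, $n_j^*:=\nabla g_j(u_j^* )\ne0$. Then $G=\{u:(u-u_j^* )\cdot n_j^*\ge0\ \forall u_j^*\in S_j,\ \forall j\}$ (geometric quasilinearization). (4) Cell average decomposition (CAD). Let $\mathbb V_K\in\{(\mathbb P^k(K))^m,\mathbb W_K\}$. There are weights $\lambda_{K,e}>0$, $\beta_{K,s}>0$ with $\sum_e\lambda_{K,e}+\sum_s\beta_{K,s}=1$ and nodes $x_{K,s}^*\in\overline K$ with $\frac1{|K|}\int_K\phi\,dx=\sum_{e\in\mathcal E_K}\lambda_{K,e}\frac1{|e|}\int_e\phi\,ds+\sum_{s=1}^{S_K}\beta_{K,s}\phi(x_{K,s}^* )$ for all $\phi\in\mathbb V_K$. Set $\mu_K:=\min_{e\in\mathcal E_K}\lambda_{K,e}|K|/|e|$. (5) Limiter and $G$-admissibility. $\Pi_K(u_K;\bar u_K)=\bar u_K+\theta_K(u_K-\bar u_K)$, where either (classic limiter, CAD on $\mathbb V_K=\mathbb W_K$) $\theta_K$ is the supremum of $\theta\in[0,1]$ with $\bar u_K+\theta(u_K(x)-\bar u_K)\in G$ for all $x\in\{x_{e,\nu}\}\cup\{x^*_{K,s}\}$, or (alternative limiter, CAD on $\mathbb V_K=(\mathbb P^k(K))^m$) $\theta_K$ is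 the supremum of $\theta\in[0,1]$ with $\bar u_K+\theta(u_K(x_{e,\nu})-\bar u_K)\in G$ for all $e,\nu$ and, if $\sum_e\lambda_{K,e}<1$, also $\bar u_K+\theta(u_K^*-\bar u_K)\in G$, with $u_K^*=\bigl(\bar u_K-\sum_e\lambda_{K,e}\frac1{|e|}\int_eu_K\,ds\bigr)/\bigl(1-\sum_e\lambda_{K,e}\bigr)$. A function $\hat u_K\in\mathbb W_K$ is $G$-admissible if $\hat u_K(x_{e,\nu})\in G$ for all $e\in\mathcal E_K$ and all $\nu$ and, when $\sum_e\lambda_{K,e}<1$, also $\bigl(\bar u_K-\sum_e\lambda_{K,e}\sum_\nu\omega_{e,\nu}\hat u_K(x_{e,\nu})\bigr)/\bigl(1-\sum_e\lambda_{K,e}\bigr)\in G$. (6) Weak Lax–Friedrichs splitting. For every $u\in G$ and unit vector $n$ there is a wave-speed bound $\tilde\alpha(u,n)\ge0$, and for every $j$, $u_j^*\in S_j$ a vector $\zeta(u_j^* )\in\mathbb R^2$, such that for every unit $n$ and all $\alpha\ge\tilde\alpha(u,n)$: $\alpha(u-u_j^* )\cdot n_j^*\pm(F(u)\cdot n)\cdot n_j^*\ge\mp\zeta(u_j^* )\cdot n$. (7) Conservative update. With $\hat u_{K,e,\nu}^n=\hat u_K^n(x_{e,\nu})$ and $\hat u_{K_e,e,\nu}^n=\hat u_{K_e}^n(x_{e,\nu})$ (on boundary edges: a prescribed exterior state in $G$), $$\bar u_K^{n+1}=\bar u_K^n-\frac{\Delta t}{|K|}\sum_{e\in\mathcal E_K}|e|\sum_\nu\omega_{e,\nu}\Bigl(\tfrac12\bigl[F(\hat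 u_{K,e,\nu}^n)+F(\hat u_{K_e,e,\nu}^n)\bigr]\cdot n_{K,e}-\tfrac{\alpha_{K,e,\nu}}2(\hat u_{K_e,e,\nu}^n-\hat u_{K,e,\nu}^n)\Bigr),$$ where $\alpha_{K,e,\nu}\ge\max\{\tilde\alpha(\hat u_{K,e,\nu}^n,n_{K,e}),\tilde\alpha(\hat u_{K_e,e,\nu}^n,n_{K,e})\}$ (Lax–Friedrichs flux). (8) Transform and point operator. $\Psi:\mathring G\to\mathbb R^m$ is a bijection, $C^1$, with $D\Psi(u)$ invertible, $\Psi,\Psi^{-1}$ locally Lipschitz, and for smooth solutions $u\in\mathring G$, $w=\Psi(u)$ satisfies $\partial_tw+\sum_iJ_i(u)\partial_{x_i}w=0$ with $J_i=D\Psi\,A_i\,(D\Psi)^{-1}$. For a direction $q$, $J_q=\sum_iq_iJ_i$. For $\sigma\in\Sigma_h$ let $\mathcal E_\sigma$ be the edges containing $x_\sigma$; for $e\in\mathcal E_\sigma$, $\tau_{\sigma,e}$ is the unit tangent oriented away from $x_\sigma$, $n_{\sigma,e}$ a unit normal such that $(n_{\sigma,e},\tau_{\sigma,e})$ is a right-handed orthonormal basis, and $n_{\sigma,e}$ points from cell $K^-_{\sigma,e}$ to cell $K^+_{\sigma,e}$. For a vertex $\sigma$, $K^{\mathrm{ext}}_{\sigma,e}$ is the cell containing $x_\sigma-\varepsilon\tau_{\sigma,e}$ for small $\varepsilon>0$ (ties broken deterministically). With $\theta_{K,\sigma}$ the interior angle of $K$ at $\sigma$, $\theta_{\sigma,e}=\frac12(\theta_{K^-_{\sigma,e},\sigma}+\theta_{K^+_{\sigma,e},\sigma})$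 (only $\frac12\theta_{K^-_{\sigma,e},\sigma}$ for a boundary edge) and $\omega_{\sigma,e}=\theta_{\sigma,e}/\sum_{e'\in\mathcal E_\sigma}\theta_{\sigma,e'}$. Choose $\alpha_\sigma>0$ not less than the spectral radii of $J_{n_{\sigma,e}}(u_\sigma),J_{\tau_{\sigma,e}}(u_\sigma)$, $e\in\mathcal E_\sigma$, and put $J_q^\pm=\frac12(J_q(u_\sigma)\pm\alpha_\sigma I)$. Put $\partial_qw_{K,\sigma}:=D\Psi(u_\sigma)(q\cdot\nabla u_K(x_\sigma))$. For a vertex, $$(\mathcal D^{\mathrm{pt}}(u_h))_\sigma=-\sum_{e\in\mathcal E_\sigma}\omega_{\sigma,e}\bigl(J^+_{n_{\sigma,e}}\partial_{n_{\sigma,e}}w_{K^-_{\sigma,e},\sigma}+J^-_{n_{\sigma,e}}\partial_{n_{\sigma,e}}w_{K^+_{\sigma,e},\sigma}+J^-_{\tau_{\sigma,e}}\partial_{\tau_{\sigma,e}}w_{K^-_{\sigma,e},\sigma}+J^+_{\tau_{\sigma,e}}\partial_{\tau_{\sigma,e}}w_{K^{\mathrm{ext}}_{\sigma,e},\sigma}\bigr);$$ for a midpoint of $e$, $$(\mathcal D^{\mathrm{pt}}(u_h))_\sigma=-\bigl(J^+_{n_{\sigma,e}}\partial_{n_{\sigma,e}}w_{K^-_{\sigma,e},\sigma}+J^-_{n_{\sigma,e}}\partial_{n_{\sigma,e}}w_{K^+_{\sigma,e},\sigma}+J_{\tau_{\sigma,e}}\partial_{\tau_{\sigma,e}}w_{K^-_{\sigma,e},\sigma}\bigr).$$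 At the boundary, missing exterior traces and directional derivatives are finite data supplied by the boundary conditions, consistent with the physical boundary data and locally Lipschitz in the interior trace and gradient data.
   Formalization: Two hypotheses are added because the claim fails without them: Δt·α_{K,e,ν} ≤ (3/2)μ_K for all K, e, ν (the text bounds α_{K,e,ν} only from below), and, when Σ_e λ_{K,e} = 1, the cell average decomposition is exact on all of W_K. *)

theory Defs
  imports "HOL-Analysis.Analysis"
begin

type_synonym cell = "(real^2) set"
type_synonym node = "real^2"
type_synonym edge = "(real^2) set"

text \<open>A discrete state: one average per cell, one value per node. A node is identified with its
  coordinates.\<close>
type_synonym 'm state = "(cell \<Rightarrow> real^'m) \<times> (node \<Rightarrow> real^'m)"

section \<open>The hyperbolic system\<close>

definition jac :: "(real^'m \<Rightarrow> real^'k) \<Rightarrow> real^'m \<Rightarrow> real^'m^'k" where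
  "jac h u = matrix (frechet_derivative h (at u))"

definition C1_on :: "(real^'m) set \<Rightarrow> (real^'m \<Rightarrow> real^'k) \<Rightarrow> bool" where
  "C1_on S h \<longleftrightarrow> (\<forall>u\<in>S. h differentiable (at u)) \<and> continuous_on S (jac h)"

definition real_diagonalizable :: "real^'m^'m \<Rightarrow> bool" where
  "real_diagonalizable M \<longleftrightarrow>
     (\<exists>(P::real^'m^'m) d. invertible P \<and> M ** P = P ** (\<chi> i j. if i = j then d i else 0))"

definition hyperbolic_on :: "(real^'m) set \<Rightarrow> (2 \<Rightarrow> real^'m \<Rightarrow> real^'m) \<Rightarrow> bool" where
  "hyperbolic_on S f \<longleftrightarrow>
     (\<forall>i. C1_on S (f i)) \<and>
     (\<forall>u\<in>S. \<forall>n::real^2. real_diagonalizable (\<Sum>i\<in>UNIV. n $ i *\<^sub>R jac (f i) u))"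

definition normal_flux :: "(2 \<Rightarrow> real^'m \<Rightarrow> real^'m) \<Rightarrow> real^'m \<Rightarrow> real^2 \<Rightarrow> real^'m" where
  "normal_flux f u n = (\<Sum>i\<in>UNIV. n $ i *\<^sub>R f i u)"

section \<open>Mesh\<close>

definition edges :: "cell \<Rightarrow> edge set" where
  "edges K = {e. e edge_of closure K}"

definition mesh_edges :: "cell set \<Rightarrow> edge set" where
  "mesh_edges T = (\<Union>K\<in>T. edges K)"

definition vertices :: "cell set \<Rightarrow> node set" where
  "vertices T = (\<Union>K\<in>T. {x. x extreme_point_of closure K})"

definition nodes :: "cell set \<Rightarrow> node set" where
  "nodes T = vertices T \<union> {midpoint a b |a b. closed_segment a b \<in> mesh_edges T}"

definition area :: "cell \<Rightarrow> real" where
  "area K = measure lebesgue K"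

text \<open>An edge is a segment, so its diameter is its length.\<close>
definition edge_length :: "edge \<Rightarrow> real" where
  "edge_length e = diameter e"

definition polygonal_cell :: "cell \<Rightarrow> bool" where
  "polygonal_cell K \<longleftrightarrow> K \<noteq> {} \<and> open K \<and> convex K \<and> polytope (closure K)"

text \<open>The constants \<open>\<rho>\<close> (shape regularity) and \<open>N\<close> (number of edges per cell) are those of the whole
  mesh family. Two closed cells of a conforming mesh meet in a common face of both (a vertex or an
  edge) or not at all.\<close>
definition conforming_mesh :: "(real^2) set \<Rightarrow> real \<Rightarrow> nat \<Rightarrow> cell set \<Rightarrow> bool" where
  "conforming_mesh \<Omega> \<rho> N T \<longleftrightarrow>
     finite T \<and>
     (\<forall>K\<in>T. polygonal_cell K) \<and>
     pairwise disjnt T \<and> \<Union>T \<subseteq> \<Omega> \<and> \<Omega> \<subseteq> (\<Union>K\<in>T. closure K) \<and>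
     (\<forall>K\<in>T. \<forall>K'\<in>T. (closure K \<inter> closure K') face_of closure K) \<and>
     (\<forall>K\<in>T. \<exists>c. ball c (\<rho> * diameter K) \<subseteq> K) \<and>
     (\<forall>K\<in>T. card (edges K) \<le> N)"

definition outward_normal :: "cell \<Rightarrow> edge \<Rightarrow> real^2" where
  "outward_normal K e = (THE n. norm n = 1 \<and> (\<forall>x\<in>e. \<forall>y\<in>K. n \<bullet> (y - x) < 0))"

definition the_cell :: "(cell \<Rightarrow> bool) \<Rightarrow> cell option" where
  "the_cell P = (if \<exists>K. P K then Some (THE K. P K) else None)"

text \<open>\<open>None\<close> encodes that \<open>e\<close> is a boundary edge.\<close>
definition neighbour :: "cell set \<Rightarrow> cell \<Rightarrow> edge \<Rightarrow> cell option" where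
  "neighbour T K e = the_cell (\<lambda>K'. K' \<in> T \<and> K' \<noteq> K \<and> e \<in> edges K')"

definition cell_mean :: "cell \<Rightarrow> (real^2 \<Rightarrow> real^'m) \<Rightarrow> real^'m" where
  "cell_mean K \<phi> = (1 / area K) *\<^sub>R integral K \<phi>"

definition edge_integral :: "edge \<Rightarrow> (real^2 \<Rightarrow> real^'m) \<Rightarrow> real^'m" where
  "edge_integral e \<phi> =
     (let (a, b) = (SOME (a, b). e = closed_segment a b)
      in edge_length e *\<^sub>R integral {0..1} (\<lambda>t. \<phi> (linepath a b t)))"

definition edge_mean :: "edge \<Rightarrow> (real^2 \<Rightarrow> real^'m) \<Rightarrow> real^'m" where
  "edge_mean e \<phi> = (1 / edge_length e) *\<^sub>R edge_integral e \<phi>"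

section \<open>Function spaces\<close>

definition poly_space :: "nat \<Rightarrow> (real^2 \<Rightarrow> real^'m) set" where
  "poly_space k =
     {\<lambda>x. \<Sum>(i,j)\<in>{(i,j). i + j \<le> k}. (x $ 1 ^ i * x $ 2 ^ j) *\<^sub>R c i j | c. True}"

primrec Ck_on :: "nat \<Rightarrow> (real^2) set \<Rightarrow> (real^2 \<Rightarrow> real^'m) \<Rightarrow> bool" where
  "Ck_on 0 S \<phi> = continuous_on S \<phi>"
| "Ck_on (Suc r) S \<phi> =
     (\<exists>d :: 2 \<Rightarrow> real^2 \<Rightarrow> real^'m.
        (\<forall>x\<in>S. (\<phi> has_derivative (\<lambda>h. \<Sum>i\<in>UNIV. h $ i *\<^sub>R d i x)) (at x within S)) \<and>
        (\<forall>i. Ck_on r S (d i)))"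

text \<open>Cell functions are total functions of which only the values on the closed cell matter. They are
  smooth up to the boundary (traces and gradients at boundary nodes are used); all
  derivatives are taken within the closed cell, where they are unique.\<close>
definition cell_space :: "nat \<Rightarrow> cell \<Rightarrow> (real^2 \<Rightarrow> real^'m) set \<Rightarrow> bool" where
  "cell_space k K W \<longleftrightarrow>
     (\<exists>B. finite B \<and> W = {\<lambda>x. \<Sum>b\<in>B. c b *\<^sub>R b x | c. True}) \<and>
     poly_space k \<subseteq> W \<and>
     (\<forall>\<phi>\<in>W. \<forall>r. Ck_on r (closure K) \<phi>)"

definition cell_grad :: "cell \<Rightarrow> (real^2 \<Rightarrow> real^'m) \<Rightarrow> real^2 \<Rightarrow> real^2^'m" where
  "cell_grad K \<phi> x = matrix (frechet_derivative \<phi> (at x within closure K))"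

section \<open>Discretization data\<close>

datatype limiter_kind = Classic | Alternative

text \<open>\<open>qnode e \<nu>\<close>, \<open>qweight e \<nu>\<close> for \<open>1 \<le> \<nu> \<le> nq\<close> is the edge quadrature; \<open>lam\<close>, \<open>nint\<close>, \<open>beta\<close>, \<open>inode\<close>
  are \<open>\<lambda>\<close>, \<open>S\<^sub>K\<close>, \<open>\<beta>\<close> and \<open>x\<^sup>*\<close> of the cell average decomposition.\<close>
record 'm discretization =
  cells :: "cell set"
  deg :: nat
  wspace :: "cell \<Rightarrow> (real^2 \<Rightarrow> real^'m) set"
  recon :: "cell \<Rightarrow> 'm state \<Rightarrow> real^2 \<Rightarrow> real^'m"
  nq :: nat
  qnode :: "edge \<Rightarrow> nat \<Rightarrow> real^2"
  qweight :: "edge \<Rightarrow> nat \<Rightarrow> real"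
  lam :: "cell \<Rightarrow> edge \<Rightarrow> real"
  nint :: "cell \<Rightarrow> nat"
  beta :: "cell \<Rightarrow> nat \<Rightarrow> real"
  inode :: "cell \<Rightarrow> nat \<Rightarrow> real^2"
  limiter :: "cell \<Rightarrow> limiter_kind"

definition reconstruction :: "'m::finite discretization \<Rightarrow> bool" where
  "reconstruction D \<longleftrightarrow>
     (\<forall>K\<in>cells D. cell_space (deg D) K (wspace D K) \<and>
       (\<forall>uh. recon D K uh \<in> wspace D K \<and> cell_mean K (recon D K uh) = fst uh K \<and>
          (\<forall>\<sigma>\<in>nodes (cells D) \<inter> frontier K. recon D K uh \<sigma> = snd uh \<sigma>)))"

definition edge_quadrature :: "'m::finite discretization \<Rightarrow> bool" where
  "edge_quadrature D \<longleftrightarrow>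
     (\<forall>K\<in>cells D. \<forall>e\<in>edges K.
       (\<forall>\<nu>\<in>{1..nq D}. qnode D e \<nu> \<in> e \<and> qnode D e \<nu> \<in> nodes (cells D) \<and> 0 < qweight D e \<nu>) \<and>
       (\<Sum>\<nu>=1..nq D. qweight D e \<nu>) = 1 \<and>
       (\<forall>\<phi>\<in>wspace D K. edge_mean e \<phi> = (\<Sum>\<nu>=1..nq D. qweight D e \<nu> *\<^sub>R \<phi> (qnode D e \<nu>))))"

definition test_space :: "'m::finite discretization \<Rightarrow> cell \<Rightarrow> (real^2 \<Rightarrow> real^'m) set" where
  "test_space D K = (case limiter D K of Classic \<Rightarrow> wspace D K | Alternative \<Rightarrow> poly_space (deg D))"

definition lam_sum :: "'m::finite discretization \<Rightarrow> cell \<Rightarrow> real" where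
  "lam_sum D K = (\<Sum>e\<in>edges K. lam D K e)"

definition cad_exact_on :: "'m::finite discretization \<Rightarrow> cell \<Rightarrow> (real^2 \<Rightarrow> real^'m) set \<Rightarrow> bool" where
  "cad_exact_on D K V \<longleftrightarrow>
     (\<forall>\<phi>\<in>V. cell_mean K \<phi> = (\<Sum>e\<in>edges K. lam D K e *\<^sub>R edge_mean e \<phi>)
                            + (\<Sum>s=1..nint D K. beta D K s *\<^sub>R \<phi> (inode D K s)))"

definition cell_average_decomposition :: "'m::finite discretization \<Rightarrow> bool" where
  "cell_average_decomposition D \<longleftrightarrow>
     (\<forall>K\<in>cells D.
       (\<forall>e\<in>edges K. 0 < lam D K e) \<and>
       (\<forall>s\<in>{1..nint D K}. 0 < beta D K s \<and> inode D K s \<in> closure K) \<and>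
       lam_sum D K + (\<Sum>s=1..nint D K. beta D K s) = 1 \<and>
       cad_exact_on D K (test_space D K))"

text \<open>If no interior weight is present, the boundary data have to determine the average of every
  function of the cell space. This is automatic for the classic limiter, where the decomposition is
  exact on \<open>wspace\<close>. For the alternative limiter, with \<open>lam_sum = 1\<close> and exactness on polynomials
  only, the point \<open>u\<^sup>*\<close> is undefined and nothing would tie the cell average to the edge values.\<close>
definition boundary_only_decomposition_exact :: "'m::finite discretization \<Rightarrow> bool" where
  "boundary_only_decomposition_exact D \<longleftrightarrow>
     (\<forall>K\<in>cells D. lam_sum D K = 1 \<longrightarrow> cad_exact_on D K (wspace D K))"

definition mu :: "'m::finite discretization \<Rightarrow> cell \<Rightarrow> real" where
  "mu D K = Min ((\<lambda>e. lam D K e * area K / edge_length e) ` edges K)"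

section \<open>Invariant domain\<close>

definition grad :: "(real^'m \<Rightarrow> real) \<Rightarrow> real^'m \<Rightarrow> real^'m" where
  "grad h u = (THE D. GDERIV h u :> D)"

definition touching :: "('j \<Rightarrow> real^'m \<Rightarrow> real) \<Rightarrow> (real^'m) set \<Rightarrow> 'j \<Rightarrow> (real^'m) set" where
  "touching g G j = frontier G \<inter> frontier {u. g j u \<ge> 0}"

definition invariant_domain ::
  "'j set \<Rightarrow> ('j \<Rightarrow> real^'m \<Rightarrow> real) \<Rightarrow> (real^'m) set \<Rightarrow> (real^'m) set \<Rightarrow> bool" where
  "invariant_domain J g G\<^sub>0 G \<longleftrightarrow>
     finite J \<and>
     G\<^sub>0 = {u. \<forall>j\<in>J. g j u > 0} \<and>
     G = closure G\<^sub>0 \<and> G = {u. \<forall>j\<in>J. g j u \<ge> 0} \<and> convex G \<and>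
     (\<forall>j\<in>J. \<exists>U. open U \<and> G \<subseteq> U \<and> concave_on U (g j) \<and>
        (\<forall>u\<in>U. GDERIV (g j) u :> grad (g j) u) \<and> continuous_on U (grad (g j))) \<and>
     (\<forall>j\<in>J. \<forall>u\<in>touching g G j. grad (g j) u \<noteq> 0)"

definition weak_LF_splitting ::
  "(2 \<Rightarrow> real^'m \<Rightarrow> real^'m) \<Rightarrow> 'j set \<Rightarrow> ('j \<Rightarrow> real^'m \<Rightarrow> real) \<Rightarrow> (real^'m) set \<Rightarrow>
   (real^'m \<Rightarrow> real^2 \<Rightarrow> real) \<Rightarrow> ('j \<Rightarrow> real^'m \<Rightarrow> real^2) \<Rightarrow> bool" where
  "weak_LF_splitting f J g G wspeed \<zeta> \<longleftrightarrow>
     (\<forall>u\<in>G. \<forall>n. norm n = 1 \<longrightarrow>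
        0 \<le> wspeed u n \<and>
        (\<forall>j\<in>J. \<forall>v\<in>touching g G j. \<forall>\<alpha>\<ge>wspeed u n.
           \<alpha> * ((u - v) \<bullet> grad (g j) v) + normal_flux f u n \<bullet> grad (g j) v \<ge> - (\<zeta> j v \<bullet> n) \<and>
           \<alpha> * ((u - v) \<bullet> grad (g j) v) - normal_flux f u n \<bullet> grad (g j) v \<ge> \<zeta> j v \<bullet> n))"

section \<open>Limiter and admissibility\<close>

definition quad_points :: "'m::finite discretization \<Rightarrow> cell \<Rightarrow> (real^2) set" where
  "quad_points D K = {qnode D e \<nu> |e \<nu>. e \<in> edges K \<and> \<nu> \<in> {1..nq D}}"

definition scaled :: "real^'m \<Rightarrow> real \<Rightarrow> real^'m \<Rightarrow> real^'m" where
  "scaled m \<theta> v = m + \<theta> *\<^sub>R (v - m)"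

definition ustar :: "'m::finite discretization \<Rightarrow> cell \<Rightarrow> (real^2 \<Rightarrow> real^'m) \<Rightarrow> real^'m \<Rightarrow> real^'m" where
  "ustar D K \<phi> m =
     (1 / (1 - lam_sum D K)) *\<^sub>R (m - (\<Sum>e\<in>edges K. lam D K e *\<^sub>R edge_mean e \<phi>))"

definition theta_feasible ::
  "'m::finite discretization \<Rightarrow> (real^'m) set \<Rightarrow> cell \<Rightarrow> (real^2 \<Rightarrow> real^'m) \<Rightarrow> real^'m \<Rightarrow> real \<Rightarrow> bool"
where
  "theta_feasible D G K \<phi> m \<theta> \<longleftrightarrow>
     (case limiter D K of
        Classic \<Rightarrow>
          (\<forall>x \<in> quad_points D K \<union> inode D K ` {1..nint D K}. scaled m \<theta> (\<phi> x) \<in> G)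
      | Alternative \<Rightarrow>
          (\<forall>x \<in> quad_points D K. scaled m \<theta> (\<phi> x) \<in> G) \<and>
          (lam_sum D K < 1 \<longrightarrow> scaled m \<theta> (ustar D K \<phi> m) \<in> G))"

definition limited ::
  "'m::finite discretization \<Rightarrow> (real^'m) set \<Rightarrow> cell \<Rightarrow> (real^2 \<Rightarrow> real^'m) \<Rightarrow> real^'m \<Rightarrow> real^2 \<Rightarrow> real^'m"
where
  "limited D G K \<phi> m x = scaled m (Sup {\<theta>\<in>{0..1}. theta_feasible D G K \<phi> m \<theta>}) (\<phi> x)"

definition limited_recon ::
  "'m::finite discretization \<Rightarrow> (real^'m) set \<Rightarrow> 'm state \<Rightarrow> cell \<Rightarrow> real^2 \<Rightarrow> real^'m" where
  "limited_recon D G uh K = limited D G K (recon D K uh) (fst uh K)"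

definition G_admissible ::
  "'m::finite discretization \<Rightarrow> (real^'m) set \<Rightarrow> cell \<Rightarrow> (real^2 \<Rightarrow> real^'m) \<Rightarrow> real^'m \<Rightarrow> bool" where
  "G_admissible D G K \<phi> m \<longleftrightarrow>
     \<phi> \<in> wspace D K \<and>
     (\<forall>e\<in>edges K. \<forall>\<nu>\<in>{1..nq D}. \<phi> (qnode D e \<nu>) \<in> G) \<and>
     (lam_sum D K < 1 \<longrightarrow>
        (1 / (1 - lam_sum D K)) *\<^sub>R
          (m - (\<Sum>e\<in>edges K. lam D K e *\<^sub>R
                  (\<Sum>\<nu>=1..nq D. qweight D e \<nu> *\<^sub>R \<phi> (qnode D e \<nu>)))) \<in> G)"

definition hybrid_admissible ::
  "'m::finite discretization \<Rightarrow> (real^'m) set \<Rightarrow> (real^'m) set \<Rightarrow> 'm state \<Rightarrow> bool" where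
  "hybrid_admissible D G\<^sub>0 G uh \<longleftrightarrow>
     (\<forall>K\<in>cells D. fst uh K \<in> G) \<and> (\<forall>\<sigma>\<in>nodes (cells D). snd uh \<sigma> \<in> G\<^sub>0)"

section \<open>Local geometry at nodes\<close>

definition edges_at :: "cell set \<Rightarrow> node \<Rightarrow> edge set" where
  "edges_at T \<sigma> = {e \<in> mesh_edges T. \<sigma> \<in> e}"

text \<open>The cell that has \<open>n\<close> as outward normal on \<open>e\<close>: this is \<open>K\<^sup>-\<close> for the normal \<open>n\<close>
  of \<open>e\<close>, and \<open>K\<^sup>+\<close> when applied to \<open>-n\<close>.\<close>
definition side_cell :: "cell set \<Rightarrow> edge \<Rightarrow> real^2 \<Rightarrow> cell option" where
  "side_cell T e n = the_cell (\<lambda>K. K \<in> T \<and> e \<in> edges K \<and> outward_normal K e = n)"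

definition interior_angle :: "cell \<Rightarrow> node \<Rightarrow> real" where
  "interior_angle K \<sigma> =
     (THE \<theta>. \<exists>a b. a \<noteq> b \<and> closed_segment \<sigma> a \<in> edges K \<and> closed_segment \<sigma> b \<in> edges K \<and>
               \<theta> = arccos (sgn (a - \<sigma>) \<bullet> sgn (b - \<sigma>)))"

text \<open>The right-handed companion: \<open>(normal_of \<tau>, \<tau>)\<close> is positively oriented.\<close>
definition normal_of :: "real^2 \<Rightarrow> real^2" where
  "normal_of \<tau> = vector [\<tau> $ 2, - (\<tau> $ 1)]"

text \<open>Only existing cells contribute to the angle weight of a boundary edge.\<close>
definition edge_angle :: "cell set \<Rightarrow> node \<Rightarrow> edge \<Rightarrow> real^2 \<Rightarrow> real" where
  "edge_angle T \<sigma> e n =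
     (let ang = (\<lambda>c. case c of None \<Rightarrow> 0 | Some K \<Rightarrow> interior_angle K \<sigma>)
      in (ang (side_cell T e n) + ang (side_cell T e (- n))) / 2)"

definition contains_near :: "cell \<Rightarrow> node \<Rightarrow> real^2 \<Rightarrow> bool" where
  "contains_near K \<sigma> q \<longleftrightarrow> (\<exists>\<delta>>0. \<forall>\<epsilon>. 0 < \<epsilon> \<and> \<epsilon> < \<delta> \<longrightarrow> \<sigma> + \<epsilon> *\<^sub>R q \<in> closure K)"

section \<open>Transform\<close>

definition loc_lipschitz_on :: "'a::metric_space set \<Rightarrow> ('a \<Rightarrow> 'b::metric_space) \<Rightarrow> bool" where
  "loc_lipschitz_on S h \<longleftrightarrow> (\<forall>x\<in>S. \<exists>\<epsilon>>0. \<exists>L. L-lipschitz_on (ball x \<epsilon> \<inter> S) h)"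

definition admissibility_transform :: "(real^'m) set \<Rightarrow> (real^'m \<Rightarrow> real^'m) \<Rightarrow> bool" where
  "admissibility_transform G\<^sub>0 \<Psi> \<longleftrightarrow>
     bij_betw \<Psi> G\<^sub>0 UNIV \<and> C1_on G\<^sub>0 \<Psi> \<and> (\<forall>u\<in>G\<^sub>0. invertible (jac \<Psi> u)) \<and>
     loc_lipschitz_on G\<^sub>0 \<Psi> \<and> loc_lipschitz_on UNIV (inv_into G\<^sub>0 \<Psi>)"

definition Jq ::
  "(2 \<Rightarrow> real^'m \<Rightarrow> real^'m) \<Rightarrow> (real^'m \<Rightarrow> real^'m) \<Rightarrow> real^'m \<Rightarrow> real^2 \<Rightarrow> real^'m^'m" where
  "Jq f \<Psi> u q =
     (\<Sum>i\<in>UNIV. q $ i *\<^sub>R (jac \<Psi> u ** jac (f i) u ** matrix_inv (jac \<Psi> u)))"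

definition complex_eigenvalue :: "real^'m^'m \<Rightarrow> complex \<Rightarrow> bool" where
  "complex_eigenvalue M z \<longleftrightarrow>
     (\<exists>v::complex^'m. v \<noteq> 0 \<and> (\<forall>i. (\<Sum>j\<in>UNIV. complex_of_real (M $ i $ j) * v $ j) = z * v $ i))"

definition spectral_radius :: "real^'m^'m \<Rightarrow> real" where
  "spectral_radius M = Sup {cmod z |z. complex_eigenvalue M z}"

section \<open>Boundary data and point operator\<close>

datatype side = Minus | Plus | Ext

text \<open>\<open>tangent\<close>, \<open>ext_cell\<close> and \<open>visc\<close> are \<open>\<tau>\<close>, \<open>K\<^sup>e\<^sup>x\<^sup>t\<close> and \<open>\<alpha>\<^sub>\<sigma>\<close>. \<open>bstate e \<nu>\<close> yields the exterior
  state on a boundary edge from the interior trace and gradient; \<open>bderiv \<sigma> e s q\<close> yields a missing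
  derivative of \<open>w\<close> in direction \<open>q\<close> from the point value and the gradients of the cells
  around \<open>\<sigma>\<close>.\<close>
record 'm point_data =
  tangent :: "node \<Rightarrow> edge \<Rightarrow> real^2"
  ext_cell :: "node \<Rightarrow> edge \<Rightarrow> cell option"
  visc :: "node \<Rightarrow> real"
  bstate :: "edge \<Rightarrow> nat \<Rightarrow> real^'m \<Rightarrow> real^2^'m \<Rightarrow> real^'m"
  bderiv :: "node \<Rightarrow> edge \<Rightarrow> side \<Rightarrow> real^2 \<Rightarrow> real^'m \<Rightarrow> (cell \<Rightarrow> real^2^'m) \<Rightarrow> real^'m"

definition edge_normal :: "'m::finite point_data \<Rightarrow> node \<Rightarrow> edge \<Rightarrow> real^2" where
  "edge_normal P \<sigma> e = normal_of (tangent P \<sigma> e)"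

definition adjacent :: "cell set \<Rightarrow> 'm::finite point_data \<Rightarrow> node \<Rightarrow> edge \<Rightarrow> side \<Rightarrow> cell option" where
  "adjacent T P \<sigma> e s =
     (case s of Minus \<Rightarrow> side_cell T e (edge_normal P \<sigma> e)
              | Plus \<Rightarrow> side_cell T e (- edge_normal P \<sigma> e)
              | Ext \<Rightarrow> ext_cell P \<sigma> e)"

text \<open>At an edge midpoint both orientations of the tangent point away from the node; either choice is
  allowed. \<open>ext_cell\<close> is any selection among the closed cells entered by the ray
  \<open>\<sigma> - \<epsilon>\<tau>\<close> (this resolves ties), and \<open>None\<close> when the ray leaves the domain.\<close>
definition node_geometry :: "cell set \<Rightarrow> 'm::finite point_data \<Rightarrow> bool" where
  "node_geometry T P \<longleftrightarrow>
     (\<forall>\<sigma>\<in>nodes T. \<forall>e\<in>edges_at T \<sigma>.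
        norm (tangent P \<sigma> e) = 1 \<and> (\<exists>t>0. \<sigma> + t *\<^sub>R tangent P \<sigma> e \<in> e)) \<and>
     (\<forall>\<sigma>\<in>vertices T. \<forall>e\<in>edges_at T \<sigma>.
        case ext_cell P \<sigma> e of
          Some K \<Rightarrow> K \<in> T \<and> contains_near K \<sigma> (- tangent P \<sigma> e)
        | None \<Rightarrow> \<not> (\<exists>K\<in>T. contains_near K \<sigma> (- tangent P \<sigma> e)))"

definition point_viscosity ::
  "(2 \<Rightarrow> real^'m \<Rightarrow> real^'m) \<Rightarrow> (real^'m \<Rightarrow> real^'m) \<Rightarrow> cell set \<Rightarrow> 'm::finite point_data \<Rightarrow>
   (node \<Rightarrow> real^'m) \<Rightarrow> bool" where
  "point_viscosity f \<Psi> T P up \<longleftrightarrow>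
     (\<forall>\<sigma>\<in>nodes T. 0 < visc P \<sigma> \<and>
        (\<forall>e\<in>edges_at T \<sigma>.
           spectral_radius (Jq f \<Psi> (up \<sigma>) (edge_normal P \<sigma> e)) \<le> visc P \<sigma> \<and>
           spectral_radius (Jq f \<Psi> (up \<sigma>) (tangent P \<sigma> e)) \<le> visc P \<sigma>))"

text \<open>Local Lipschitz continuity in the pair (point value, gradients of the finitely many cells
  touching \<open>\<sigma>\<close>); written out because the function space of gradient families carries no metric.\<close>
definition trace_gradient_lipschitz ::
  "cell set \<Rightarrow> (real^'m) set \<Rightarrow> node \<Rightarrow> (real^'m \<Rightarrow> (cell \<Rightarrow> real^2^'m) \<Rightarrow> real^'m) \<Rightarrow> bool" where
  "trace_gradient_lipschitz T S \<sigma> b \<longleftrightarrow>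
     (let N = {K\<in>T. \<sigma> \<in> closure K} in
      \<forall>v\<^sub>0\<in>S. \<forall>A\<^sub>0. \<exists>\<epsilon>>0. \<exists>L. \<forall>v\<in>S \<inter> ball v\<^sub>0 \<epsilon>. \<forall>v'\<in>S \<inter> ball v\<^sub>0 \<epsilon>. \<forall>A A'.
        (\<forall>K\<in>N. A K \<in> ball (A\<^sub>0 K) \<epsilon> \<and> A' K \<in> ball (A\<^sub>0 K) \<epsilon>) \<longrightarrow>
        dist (b v A) (b v' A') \<le> L * (dist v v' + (\<Sum>K\<in>N. dist (A K) (A' K))))"

definition boundary_conditions ::
  "'m::finite discretization \<Rightarrow> 'm point_data \<Rightarrow> (real^'m) set \<Rightarrow> (real^'m) set \<Rightarrow> bool" where
  "boundary_conditions D P G\<^sub>0 G \<longleftrightarrow>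
     (\<forall>K\<in>cells D. \<forall>e\<in>edges K. neighbour (cells D) K e = None \<longrightarrow>
        (\<forall>\<nu>\<in>{1..nq D}. (\<forall>v\<in>G. \<forall>A. bstate P e \<nu> v A \<in> G) \<and>
           loc_lipschitz_on (G \<times> UNIV) (\<lambda>(v, A). bstate P e \<nu> v A))) \<and>
     (\<forall>\<sigma>\<in>nodes (cells D). \<forall>e\<in>edges_at (cells D) \<sigma>. \<forall>s. adjacent (cells D) P \<sigma> e s = None \<longrightarrow>
        (\<forall>q\<in>{edge_normal P \<sigma> e, tangent P \<sigma> e}.
           trace_gradient_lipschitz (cells D) G\<^sub>0 \<sigma> (bderiv P \<sigma> e s q)))"

definition dir_deriv_w ::
  "(real^'m \<Rightarrow> real^'m) \<Rightarrow> 'm::finite discretization \<Rightarrow> 'm point_data \<Rightarrow> 'm state \<Rightarrow>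
   node \<Rightarrow> edge \<Rightarrow> side \<Rightarrow> real^2 \<Rightarrow> real^'m" where
  "dir_deriv_w \<Psi> D P uh \<sigma> e s q =
     (case adjacent (cells D) P \<sigma> e s of
        Some K \<Rightarrow> jac \<Psi> (snd uh \<sigma>) *v (cell_grad K (recon D K uh) \<sigma> *v q)
      | None \<Rightarrow> bderiv P \<sigma> e s q (snd uh \<sigma>) (\<lambda>K. cell_grad K (recon D K uh) \<sigma>))"

definition point_operator ::
  "(2 \<Rightarrow> real^'m \<Rightarrow> real^'m) \<Rightarrow> (real^'m \<Rightarrow> real^'m) \<Rightarrow> 'm::finite discretization \<Rightarrow> 'm point_data \<Rightarrow>
   'm state \<Rightarrow> node \<Rightarrow> real^'m" where
  "point_operator f \<Psi> D P uh \<sigma> =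
     (let T = cells D;
          Jd = Jq f \<Psi> (snd uh \<sigma>);
          Jp = (\<lambda>q. (1/2) *\<^sub>R (Jd q + visc P \<sigma> *\<^sub>R mat 1));
          Jm = (\<lambda>q. (1/2) *\<^sub>R (Jd q - visc P \<sigma> *\<^sub>R mat 1));
          \<tau> = tangent P \<sigma>;
          n = edge_normal P \<sigma>;
          dw = dir_deriv_w \<Psi> D P uh \<sigma>
      in if \<sigma> \<in> vertices T then
           - (\<Sum>e\<in>edges_at T \<sigma>.
                (edge_angle T \<sigma> e (n e) / (\<Sum>e'\<in>edges_at T \<sigma>. edge_angle T \<sigma> e' (n e'))) *\<^sub>R
                (Jp (n e) *v dw e Minus (n e) + Jm (n e) *v dw e Plus (n e)
                 + Jm (\<tau> e) *v dw e Minus (\<tau> e) + Jp (\<tau> e) *v dw e Ext (\<tau> e)))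
         else
           (let e = (THE e. e \<in> edges_at T \<sigma>) in
            - (Jp (n e) *v dw e Minus (n e) + Jm (n e) *v dw e Plus (n e)
               + Jd (\<tau> e) *v dw e Minus (\<tau> e))))"

section \<open>Forward Euler stage\<close>

definition inner_trace ::
  "'m::finite discretization \<Rightarrow> (real^'m) set \<Rightarrow> 'm state \<Rightarrow> cell \<Rightarrow> edge \<Rightarrow> nat \<Rightarrow> real^'m" where
  "inner_trace D G uh K e \<nu> = limited_recon D G uh K (qnode D e \<nu>)"

definition outer_trace ::
  "'m::finite discretization \<Rightarrow> 'm point_data \<Rightarrow> (real^'m) set \<Rightarrow> 'm state \<Rightarrow> cell \<Rightarrow> edge \<Rightarrow> nat \<Rightarrow> real^'m"
where
  "outer_trace D P G uh K e \<nu> =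
     (case neighbour (cells D) K e of
        Some K' \<Rightarrow> inner_trace D G uh K' e \<nu>
      | None \<Rightarrow> bstate P e \<nu> (inner_trace D G uh K e \<nu>)
                  (cell_grad K (limited_recon D G uh K) (qnode D e \<nu>)))"

definition average_update ::
  "(2 \<Rightarrow> real^'m \<Rightarrow> real^'m) \<Rightarrow> 'm::finite discretization \<Rightarrow> 'm point_data \<Rightarrow> (real^'m) set \<Rightarrow>
   (cell \<Rightarrow> edge \<Rightarrow> nat \<Rightarrow> real) \<Rightarrow> real \<Rightarrow> 'm state \<Rightarrow> cell \<Rightarrow> real^'m" where
  "average_update f D P G \<alpha> \<Delta>t uh K =
     fst uh K - (\<Delta>t / area K) *\<^sub>R
       (\<Sum>e\<in>edges K. edge_length e *\<^sub>R
         (\<Sum>\<nu>=1..nq D. qweight D e \<nu> *\<^sub>R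
           (let ui = inner_trace D G uh K e \<nu>; uo = outer_trace D P G uh K e \<nu>;
                n = outward_normal K e
            in (1/2) *\<^sub>R (normal_flux f ui n + normal_flux f uo n) - (\<alpha> K e \<nu> / 2) *\<^sub>R (uo - ui))))"

definition point_update ::
  "(2 \<Rightarrow> real^'m \<Rightarrow> real^'m) \<Rightarrow> (real^'m \<Rightarrow> real^'m) \<Rightarrow> 'm::finite discretization \<Rightarrow> 'm point_data \<Rightarrow>
   (real^'m) set \<Rightarrow> real \<Rightarrow> 'm state \<Rightarrow> node \<Rightarrow> real^'m" where
  "point_update f \<Psi> D P G\<^sub>0 \<Delta>t uh \<sigma> =
     inv_into G\<^sub>0 \<Psi> (\<Psi> (snd uh \<sigma>) + \<Delta>t *\<^sub>R point_operator f \<Psi> D P uh \<sigma>)"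

definition LF_viscosity ::
  "'m::finite discretization \<Rightarrow> 'm point_data \<Rightarrow> (real^'m) set \<Rightarrow> (real^'m \<Rightarrow> real^2 \<Rightarrow> real) \<Rightarrow>
   'm state \<Rightarrow> (cell \<Rightarrow> edge \<Rightarrow> nat \<Rightarrow> real) \<Rightarrow> bool" where
  "LF_viscosity D P G wspeed uh \<alpha> \<longleftrightarrow>
     (\<forall>K\<in>cells D. \<forall>e\<in>edges K. \<forall>\<nu>\<in>{1..nq D}.
        \<alpha> K e \<nu> \<ge> max (wspeed (inner_trace D G uh K e \<nu>) (outward_normal K e))
                       (wspeed (outer_trace D P G uh K e \<nu>) (outward_normal K e)))"

definition cell_speed ::
  "'m::finite discretization \<Rightarrow> (real^'m) set \<Rightarrow> (real^'m \<Rightarrow> real^2 \<Rightarrow> real) \<Rightarrow> 'm state \<Rightarrow> cell \<Rightarrow> real"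
where
  "cell_speed D G wspeed uh K =
     Max {wspeed (inner_trace D G uh K e \<nu>) (outward_normal K e) |e \<nu>.
            e \<in> edges K \<and> \<nu> \<in> {1..nq D}}"

text \<open>In \<open>ereal\<close> a positive number divided by 0 is \<open>\<infinity>\<close>: a cell with zero speed imposes no
  restriction.\<close>
definition cfl_condition ::
  "'m::finite discretization \<Rightarrow> (real^'m) set \<Rightarrow> (real^'m \<Rightarrow> real^2 \<Rightarrow> real) \<Rightarrow> 'm state \<Rightarrow> real \<Rightarrow> bool"
where
  "cfl_condition D G wspeed uh \<Delta>t \<longleftrightarrow>
     ereal \<Delta>t \<le> (INF K\<in>cells D. ereal (mu D K) / ereal (2 * cell_speed D G wspeed uh K))"

text \<open>The speed in \<open>cfl_condition\<close> only sees the interior traces of a cell, whereas the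
  flux viscosity \<open>\<alpha>\<close> must dominate the exterior speeds as well and is otherwise arbitrary. The
  viscosity in use must therefore also be compatible with the step: \<open>\<Delta>t \<le> 3\<mu>\<^sub>K / (2\<alpha>)\<close>. Under
  \<open>cfl_condition\<close> this holds in particular whenever \<open>\<alpha>\<close> is at most three times the cell speed. It
  does not follow from \<open>cfl_condition\<close>: for \<open>f = 0\<close> and a tiny constant speed
  bound, a large \<open>\<alpha>\<close> moves the average out of \<open>G\<close>.\<close>
definition viscosity_step_compatible ::
  "'m::finite discretization \<Rightarrow> (cell \<Rightarrow> edge \<Rightarrow> nat \<Rightarrow> real) \<Rightarrow> real \<Rightarrow> bool" where
  "viscosity_step_compatible D \<alpha> \<Delta>t \<longleftrightarrow>
     (\<forall>K\<in>cells D. \<forall>e\<in>edges K. \<forall>\<nu>\<in>{1..nq D}. \<Delta>t * \<alpha> K e \<nu> \<le> 3 / 2 * mu D K)"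

end

theory Submission
  imports Defs
begin

text \<open>
  The point values are safe by construction: \<open>\<Psi>\<close> maps \<open>G\<^sub>0\<close> onto the whole space, so whatever the point
  operator returns, the inverse transform lands in \<open>G\<^sub>0\<close> (\<open>point_update_in_domain\<close>).

  For the averages, \<open>G\<close> is first written as an intersection of half-spaces
  \<open>(u - v) \<bullet> grad (g j) v \<ge> 0\<close>, one for each touching point \<open>v\<close>
  (\<open>geometric_quasilinearization\<close>). This makes membership of the updated average a family of affine
  inequalities, and the update is affine in the fluxes. Fix one half-space and let \<open>L\<close> be its affine
  function. Two expressions meet.

  The old average is a combination of the edge traces, with weight \<open>\<lambda>\<^sub>K\<^sub>,\<^sub>e \<omega>\<^sub>e\<^sub>,\<^sub>\<nu>\<close> on each, and of one
  further point of \<open>G\<close> that carries the remaining weight (\<open>average_from_traces\<close>). So \<open>L\<close> of the old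
  average is at least \<open>\<Sum> \<lambda>\<^sub>K\<^sub>,\<^sub>e \<omega>\<^sub>e\<^sub>,\<^sub>\<nu> L(u\<^sub>i)\<close>, a sum of nonnegative terms.

  The weak Lax--Friedrichs inequalities bound the flux in the gradient direction by
  \<open>(s + \<alpha>) L(u\<^sub>i) / 2 - \<zeta> \<bullet> n\<close>, where \<open>s\<close> is the speed of the cell (\<open>LF_flux_bound\<close>). The exterior trace
  drops out, because the viscous term is exactly what its own inequality asks for. The part \<open>\<zeta> \<bullet> n\<close> does
  not vanish pointwise, but \<open>\<zeta>\<close> depends on the touching point alone, so over the cell it sums to
  \<open>\<zeta> \<bullet> (\<Sum> \<bar>e\<bar> n\<^sub>e) = 0\<close>. The CFL condition and the bound on the viscosity make what is left of the flux
  at most \<open>\<Sum> \<lambda>\<^sub>K\<^sub>,\<^sub>e \<omega>\<^sub>e\<^sub>,\<^sub>\<nu> L(u\<^sub>i)\<close> (\<open>weighted_flux_bound\<close>), and the two expressions balance.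

  The plane geometry behind this is proved from the definition of edges as one-dimensional faces of a
  polytope: the boundary of a convex polygon is a closed chain of vectors
  (\<open>sum_length_outward_normal\<close>), and at most two cells share an edge, so that the exterior trace really
  belongs to a cell of the mesh (\<open>neighbour_Some\<close>).
\<close>

section \<open>Geometric quasilinearization\<close>

text \<open>Restriction to the line through \<open>v\<close> and \<open>u\<close> reduces this to the tangent inequality for convex functions
  of one real variable.\<close>
lemma concave_on_below_tangent:
  fixes h :: "'a::real_inner \<Rightarrow> real"
  assumes conc: "concave_on U h" and "open U" and v: "v \<in> U" and u: "u \<in> U"
    and deriv: "GDERIV h v :> d"
  shows "h u \<le> h v + (u - v) \<bullet> d"
proof -
  define l where "l = (\<lambda>t::real. v + t *\<^sub>R (u - v))"
  define A where "A = l -` U"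
  have "open A"
    unfolding A_def l_def by (intro continuous_open_vimage \<open>open U\<close> continuous_intros)
  have "convex U" and cvx: "convex_on U (\<lambda>x. - h x)"
    using conc by (auto simp: concave_on_def convex_on_def)
  have l_comb: "l ((1 - t) * r + t * s) = (1 - t) *\<^sub>R l r + t *\<^sub>R l s" for r s t
    by (simp add: l_def algebra_simps)
  have "convex A"
    unfolding convex_alt
  proof (intro ballI allI impI)
    fix r s t :: real assume "r \<in> A" "s \<in> A" "0 \<le> t \<and> t \<le> 1"
    then show "(1 - t) *\<^sub>R r + t *\<^sub>R s \<in> A"
      using convexD_alt[OF \<open>convex U\<close>, of "l r" "l s" t] by (simp add: A_def l_comb)
  qed
  have "convex_on A (\<lambda>t. - h (l t))"
  proof (rule convex_onI)
    fix t r s :: real assume t: "0 < t" "t < 1" and "r \<in> A" "s \<in> A"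
    then have "l r \<in> U" "l s \<in> U" by (auto simp: A_def)
    then show "- h (l ((1 - t) *\<^sub>R r + t *\<^sub>R s)) \<le> (1 - t) * - h (l r) + t * - h (l s)"
      using convex_onD[OF cvx, of t "l r" "l s"] t by (simp add: l_comb)
  qed fact
  moreover have "((\<lambda>t. - h (l t)) has_field_derivative - ((u - v) \<bullet> d)) (at 0 within A)"
  proof -
    have "(h has_derivative (\<lambda>x. x \<bullet> d)) (at (l 0))"
      using deriv by (simp add: gderiv_def l_def)
    moreover have "(l has_derivative (\<lambda>t. t *\<^sub>R (u - v))) (at 0 within A)"
      unfolding l_def by (auto intro!: derivative_eq_intros)
    ultimately have "((\<lambda>t. h (l t)) has_derivative (\<lambda>t. (t *\<^sub>R (u - v)) \<bullet> d)) (at 0 within A)"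
      by (rule has_derivative_compose[rotated])
    then have "((\<lambda>t. - h (l t)) has_derivative (\<lambda>t. - ((t *\<^sub>R (u - v)) \<bullet> d))) (at 0 within A)"
      by (rule has_derivative_minus)
    moreover have "(\<lambda>t. - ((t *\<^sub>R (u - v)) \<bullet> d)) = (*) (- ((u - v) \<bullet> d))" by auto
    ultimately show ?thesis unfolding has_field_derivative_def by simp
  qed
  moreover have "0 \<in> A" "1 \<in> A" using u v by (auto simp: A_def l_def)
  ultimately have "- h (l 1) - - h (l 0) \<ge> - ((u - v) \<bullet> d) * (1 - 0)"
    using \<open>open A\<close> \<open>convex A\<close>
    by (intro convex_on_imp_above_tangent[where A = A]) (auto simp: interior_open convex_connected)
  then show ?thesis by (simp add: l_def)
qed

lemma invariant_domain_constraint: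
  assumes "invariant_domain J g G\<^sub>0 G" and "j \<in> J"
  obtains U where "open U" "G \<subseteq> U" "concave_on U (g j)" "continuous_on U (g j)"
    and "\<And>u. u \<in> U \<Longrightarrow> GDERIV (g j) u :> grad (g j) u"
proof -
  obtain U where U: "open U" "G \<subseteq> U" "concave_on U (g j)"
    and d: "\<And>u. u \<in> U \<Longrightarrow> GDERIV (g j) u :> grad (g j) u"
    using assms unfolding invariant_domain_def by blast
  have "continuous_on U (g j)"
    using d unfolding gderiv_def
    by (intro continuous_at_imp_continuous_on ballI has_derivative_continuous) blast
  with U d show ?thesis using that by blast
qed

text \<open>If \<open>g j\<close> were positive at \<open>v\<close>, it would be nonnegative in a neighbourhood by continuity, and \<open>v\<close>
  would lie in the interior of the constraint set instead of on its frontier.\<close>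
lemma touching_zero:
  assumes dom: "invariant_domain J g G\<^sub>0 G" and j: "j \<in> J" and v: "v \<in> touching g G j"
  shows "v \<in> G" and "g j v = 0"
proof -
  have "closed G" using dom unfolding invariant_domain_def by (metis closed_closure)
  then show "v \<in> G" using v by (auto simp: touching_def frontier_def)
  then have ge: "g j v \<ge> 0" using dom j by (auto simp: invariant_domain_def)
  obtain U where U: "open U" "G \<subseteq> U" "continuous_on U (g j)"
    using invariant_domain_constraint[OF dom j] by metis
  have "g j v \<le> 0"
  proof (rule ccontr)
    assume "\<not> g j v \<le> 0"
    then have "v \<in> U \<inter> g j -` {0<..}" using \<open>v \<in> G\<close> U(2) by auto
    moreover have "open (U \<inter> g j -` {0<..})"
      using U(1,3) by (intro continuous_open_preimage) auto
    moreover have "U \<inter> g j -` {0<..} \<subseteq> {u. g j u \<ge> 0}" by auto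
    ultimately have "v \<in> interior {u. g j u \<ge> 0}" by (meson interiorI)
    then show False using v by (simp add: touching_def frontier_def)
  qed
  with ge show "g j v = 0" by simp
qed

text \<open>The strict inequalities define \<open>G\<^sub>0\<close> over the whole space, but the \<open>g j\<close> are only known to be continuous
  near \<open>G\<close>; hence openness is checked within those neighbourhoods.\<close>
lemma open_strict_domain:
  assumes dom: "invariant_domain J g G\<^sub>0 G"
  shows "open G\<^sub>0"
proof -
  have fin: "finite J" and G0: "G\<^sub>0 = {u. \<forall>j\<in>J. g j u > 0}" and "G = closure G\<^sub>0"
    using dom unfolding invariant_domain_def by blast+
  then have sub: "G\<^sub>0 \<subseteq> G" by (simp only: closure_subset)
  have "\<forall>j\<in>J. \<exists>V. open V \<and> G\<^sub>0 \<subseteq> V \<and> V \<subseteq> {u. g j u > 0}"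
  proof
    fix j assume j: "j \<in> J"
    obtain U where U: "open U" "G \<subseteq> U" "continuous_on U (g j)"
      using invariant_domain_constraint[OF dom j] by metis
    have "open (U \<inter> g j -` {0<..})"
      using U(1,3) by (intro continuous_open_preimage) auto
    moreover have "G\<^sub>0 \<subseteq> U \<inter> g j -` {0<..}" using sub U(2) G0 j by auto
    ultimately show "\<exists>V. open V \<and> G\<^sub>0 \<subseteq> V \<and> V \<subseteq> {u. g j u > 0}"
      by (intro exI[of _ "U \<inter> g j -` {0<..}"]) auto
  qed
  then obtain V where V: "\<And>j. j \<in> J \<Longrightarrow> open (V j) \<and> G\<^sub>0 \<subseteq> V j \<and> V j \<subseteq> {u. g j u > 0}"
    by metis
  then have "G\<^sub>0 = (\<Inter>j\<in>J. V j)" using G0 by blast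
  then show ?thesis using V fin by auto
qed

text \<open>Points of \<open>G\<close> satisfy the half-space inequalities by concavity, since \<open>g j\<close> vanishes at touching
  points. Conversely, the segment from a point \<open>u0\<close> of \<open>G\<^sub>0\<close> to a point \<open>u\<close> outside \<open>G\<close> crosses the frontier
  of \<open>G\<close> at some \<open>v\<close>. Some constraint is active there, and it is positive at \<open>u0\<close>, so by concavity it
  strictly decreases along the segment at \<open>v\<close>. Thus \<open>v\<close> is a touching point of this constraint, and its
  half-space separates \<open>u\<close> from \<open>G\<close>.\<close>
theorem geometric_quasilinearization:
  assumes dom: "invariant_domain J g G\<^sub>0 G" and "G \<noteq> {}"
  shows "u \<in> G \<longleftrightarrow> (\<forall>j\<in>J. \<forall>v\<in>touching g G j. (u - v) \<bullet> grad (g j) v \<ge> 0)"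
proof
  assume u: "u \<in> G"
  show "\<forall>j\<in>J. \<forall>v\<in>touching g G j. (u - v) \<bullet> grad (g j) v \<ge> 0"
  proof (intro ballI)
    fix j v assume j: "j \<in> J" and v: "v \<in> touching g G j"
    note zero = touching_zero[OF dom j v]
    obtain U where U: "open U" "G \<subseteq> U" "concave_on U (g j)"
      and d: "\<And>u. u \<in> U \<Longrightarrow> GDERIV (g j) u :> grad (g j) u"
      using invariant_domain_constraint[OF dom j] by metis
    have "g j u \<le> g j v + (u - v) \<bullet> grad (g j) v"
      using concave_on_below_tangent[OF U(3,1)] U(2) zero(1) u d by blast
    moreover have "g j u \<ge> 0" using dom j u by (auto simp: invariant_domain_def)
    ultimately show "(u - v) \<bullet> grad (g j) v \<ge> 0" using zero(2) by simp
  qed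
next
  assume half: "\<forall>j\<in>J. \<forall>v\<in>touching g G j. (u - v) \<bullet> grad (g j) v \<ge> 0"
  show "u \<in> G"
  proof (rule ccontr)
    assume "u \<notin> G"
    have "closed G" and G0: "G\<^sub>0 = {u. \<forall>j\<in>J. g j u > 0}" and cl: "G = closure G\<^sub>0"
      and G: "G = {u. \<forall>j\<in>J. g j u \<ge> 0}"
      using dom closed_closure unfolding invariant_domain_def by auto
    then obtain u0 where u0: "u0 \<in> G\<^sub>0" using \<open>G \<noteq> {}\<close> by fastforce
    then have u0G: "u0 \<in> G" using cl closure_subset by auto
    have "closed_segment u0 u \<inter> frontier G \<noteq> {}"
      using u0G \<open>u \<notin> G\<close> by (intro connected_Int_frontier) auto
    then obtain v where vs: "v \<in> closed_segment u0 u" and vf: "v \<in> frontier G" by blast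
    have vG: "v \<in> G" using vf \<open>closed G\<close> by (auto simp: frontier_def)
    have "v \<notin> G\<^sub>0"
      using vf open_strict_domain[OF dom] cl by (metis DiffD2 closure_subset frontier_def interiorI)
    then obtain j where j: "j \<in> J" and zero: "g j v = 0"
      using vG G0 G by force
    obtain U where U: "open U" "G \<subseteq> U" "concave_on U (g j)"
      and d: "\<And>u. u \<in> U \<Longrightarrow> GDERIV (g j) u :> grad (g j) u"
      using invariant_domain_constraint[OF dom j] by metis
    have pos: "g j u0 > 0" using u0 j G0 by simp
    then have inward: "(u0 - v) \<bullet> grad (g j) v > 0"
      using concave_on_below_tangent[OF U(3,1), of v u0] U(2) vG u0G d zero by force
    obtain t where t: "0 \<le> t" "t \<le> 1" "v = (1 - t) *\<^sub>R u0 + t *\<^sub>R u"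
      using vs by (auto simp: closed_segment_def)
    have "t \<noteq> 1" using t(3) vG \<open>u \<notin> G\<close> by auto
    have "t \<noteq> 0" using t(3) zero pos by auto
    have dir: "u - v = - ((1 - t) / t) *\<^sub>R (u0 - v)"
    proof -
      have "t *\<^sub>R (u - v) = - (1 - t) *\<^sub>R (u0 - v)"
        unfolding t(3) by (simp add: algebra_simps)
      also have "\<dots> = t *\<^sub>R (- ((1 - t) / t) *\<^sub>R (u0 - v))" 
        using \<open>t \<noteq> 0\<close> by (simp del: scaleR_minus_left)
      finally show ?thesis using \<open>t \<noteq> 0\<close> by (simp only: scaleR_cancel_left) simp
    qed
    have outward: "(u - v) \<bullet> grad (g j) v < 0"
      unfolding dir using inward t \<open>t \<noteq> 0\<close> \<open>t \<noteq> 1\<close> by (simp add: mult_pos_pos divide_pos_pos)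
    \<comment> \<open>Just beyond \<open>v\<close> the constraint is negative. The step \<open>s\<close> keeps the point inside the ball on which
        the tangent inequality is available.\<close>
    have "v \<notin> interior {x. g j x \<ge> 0}"
    proof
      assume "v \<in> interior {x. g j x \<ge> 0}"
      then have "v \<in> interior {x. g j x \<ge> 0} \<inter> U" using vG U(2) by auto
      moreover have "open (interior {x. g j x \<ge> 0} \<inter> U)" using U(1) by auto
      ultimately obtain \<epsilon> where \<epsilon>: "\<epsilon> > 0" "ball v \<epsilon> \<subseteq> interior {x. g j x \<ge> 0} \<inter> U"
        using open_contains_ball by blast
      define s where "s = \<epsilon> / (2 * (norm (u - v) + 1))"
      define x where "x = v + s *\<^sub>R (u - v)"
      have "s > 0" unfolding s_def using \<epsilon>(1) by (simp add: add_nonneg_pos)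
      have "norm (s *\<^sub>R (u - v)) = \<epsilon> * (norm (u - v) / (2 * (norm (u - v) + 1)))"
        using \<epsilon>(1) by (simp add: s_def)
      also have "\<dots> < \<epsilon> * 1"
      proof -
        have "norm (u - v) / (2 * (norm (u - v) + 1)) < 1"
          by (simp add: divide_less_eq add_nonneg_pos)
        then show ?thesis using \<epsilon>(1) mult_strict_left_mono by blast
      qed
      finally have "x \<in> ball v \<epsilon>" by (simp add: x_def dist_norm)
      then have "x \<in> U" "g j x \<ge> 0" using \<epsilon>(2) interior_subset by blast+
      moreover have "g j x \<le> g j v + (x - v) \<bullet> grad (g j) v"
        using concave_on_below_tangent[OF U(3,1)] U(2) vG \<open>x \<in> U\<close> d by blast
      ultimately have "s * ((u - v) \<bullet> grad (g j) v) \<ge> 0" using zero by (simp add: x_def)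
      then show False using \<open>s > 0\<close> outward by (simp add: zero_le_mult_iff)
    qed
    moreover have "v \<in> closure {x. g j x \<ge> 0}" using zero closure_subset by force
    ultimately have "v \<in> touching g G j" using vf by (simp add: touching_def frontier_def)
    then show False using half j outward by force
  qed
qed


section \<open>Plane vectors and their normals\<close>

lemma inner_real2: "(x::real^2) \<bullet> y = x $ 1 * y $ 1 + x $ 2 * y $ 2"
  by (simp add: inner_vec_def sum_2)

lemma normal_of_component [simp]: "normal_of \<tau> $ 1 = \<tau> $ 2" "normal_of \<tau> $ 2 = - (\<tau> $ 1)"
  by (simp_all add: normal_of_def)

lemma linear_normal_of: "linear normal_of"
  by (rule linearI) (auto simp: vec_eq_iff forall_2)

lemma norm_normal_of [simp]: "norm (normal_of \<tau>) = norm \<tau>"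
  by (simp add: norm_eq_sqrt_inner inner_real2 add.commute)

lemma normal_of_orthogonal [simp]: "normal_of \<tau> \<bullet> \<tau> = 0"
  by (simp add: inner_real2)

lemma normal_of_antisym: "normal_of x \<bullet> y = - (normal_of y \<bullet> x)"
  by (simp add: inner_real2)

lemma orthogonal_to_tangent:
  assumes "x \<bullet> \<tau> = 0"
  shows "(\<tau> \<bullet> \<tau>) *\<^sub>R x = (x \<bullet> normal_of \<tau>) *\<^sub>R normal_of \<tau>"
proof -
  have "x $ 1 * \<tau> $ 1 + x $ 2 * \<tau> $ 2 = 0" using assms by (simp add: inner_real2)
  then have "(\<tau> $ 1 * \<tau> $ 1 + \<tau> $ 2 * \<tau> $ 2) * x $ 1
               = (x $ 1 * \<tau> $ 2 - x $ 2 * \<tau> $ 1) * \<tau> $ 2"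
    and "(\<tau> $ 1 * \<tau> $ 1 + \<tau> $ 2 * \<tau> $ 2) * x $ 2
               = (x $ 1 * \<tau> $ 2 - x $ 2 * \<tau> $ 1) * - \<tau> $ 1"
    by algebra+
  then show ?thesis by (simp add: vec_eq_iff forall_2 inner_real2)
qed

lemma parallel_to_tangent:
  assumes "normal_of \<tau> \<bullet> x = 0" and "\<tau> \<noteq> 0"
  obtains c where "x = c *\<^sub>R \<tau>"
proof -
  have "(\<tau> \<bullet> \<tau>) *\<^sub>R x = (x \<bullet> \<tau>) *\<^sub>R \<tau>"
  proof -
    have "\<tau> $ 2 * x $ 1 = \<tau> $ 1 * x $ 2" using assms(1) by (simp add: inner_real2)
    then have "(\<tau> $ 1 * \<tau> $ 1 + \<tau> $ 2 * \<tau> $ 2) * x $ 1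
                 = (x $ 1 * \<tau> $ 1 + x $ 2 * \<tau> $ 2) * \<tau> $ 1"
      and "(\<tau> $ 1 * \<tau> $ 1 + \<tau> $ 2 * \<tau> $ 2) * x $ 2
                 = (x $ 1 * \<tau> $ 1 + x $ 2 * \<tau> $ 2) * \<tau> $ 2"
      by algebra+
    then show ?thesis by (simp add: vec_eq_iff forall_2 inner_real2)
  qed
  then have "inverse (\<tau> \<bullet> \<tau>) *\<^sub>R ((\<tau> \<bullet> \<tau>) *\<^sub>R x) = inverse (\<tau> \<bullet> \<tau>) *\<^sub>R ((x \<bullet> \<tau>) *\<^sub>R \<tau>)"
    by simp
  then have "x = (inverse (\<tau> \<bullet> \<tau>) * (x \<bullet> \<tau>)) *\<^sub>R \<tau>"
    using assms(2) by simp
  then show ?thesis using that by blast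
qed

text \<open>In the plane a unit vector orthogonal to a given nonzero vector is determined up to sign.
  So an edge leaves only two candidates for its normal.\<close>
lemma unit_normal_cases:
  assumes "norm n = 1" and "n \<bullet> \<tau> = 0" and "\<tau> \<noteq> 0"
  shows "norm \<tau> *\<^sub>R n = normal_of \<tau> \<or> norm \<tau> *\<^sub>R n = - normal_of \<tau>"
proof -
  define s where "s = n \<bullet> normal_of \<tau>"
  have eq: "(norm \<tau> * norm \<tau>) *\<^sub>R n = s *\<^sub>R normal_of \<tau>"
    using orthogonal_to_tangent[OF assms(2)]
    by (simp add: s_def dot_square_norm power2_eq_square)
  then have "norm ((norm \<tau> * norm \<tau>) *\<^sub>R n) = norm (s *\<^sub>R normal_of \<tau>)" by simp
  then have "\<bar>s\<bar> = norm \<tau>" using assms(1,3) by simp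
  then consider "s = norm \<tau>" | "s = - norm \<tau>" by linarith
  then show ?thesis
  proof cases
    case 1
    then have "norm \<tau> *\<^sub>R (norm \<tau> *\<^sub>R n) = norm \<tau> *\<^sub>R normal_of \<tau>" using eq by simp
    then show ?thesis using assms(3) by (simp only: scaleR_cancel_left) simp
  next
    case 2
    then have "norm \<tau> *\<^sub>R (norm \<tau> *\<^sub>R n) = norm \<tau> *\<^sub>R (- normal_of \<tau>)" using eq by simp
    then show ?thesis using assms(3) by (simp only: scaleR_cancel_left) simp
  qed
qed

lemma unit_normals_agree_up_to_sign:
  fixes n n' :: "real^2"
  assumes "norm n = 1" "n \<bullet> \<tau> = 0" "norm n' = 1" "n' \<bullet> \<tau> = 0" "\<tau> \<noteq> 0"
  shows "n' = n \<or> n' = - n"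
proof -
  have "norm \<tau> *\<^sub>R n' = norm \<tau> *\<^sub>R n \<or> norm \<tau> *\<^sub>R n' = norm \<tau> *\<^sub>R (- n)"
    using unit_normal_cases[OF assms(1,2,5)] unit_normal_cases[OF assms(3,4,5)]
    by (metis minus_minus scaleR_minus_right)
  then show ?thesis using assms(5) by (simp only: scaleR_cancel_left norm_eq_zero) simp
qed

section \<open>Edges of a convex polygon\<close>

lemma polygonal_cell_interior_closure: "polygonal_cell K \<Longrightarrow> interior (closure K) = K"
  by (simp add: polygonal_cell_def convex_interior_closure interior_open)

lemma polygonal_cell_polyhedron: "polygonal_cell K \<Longrightarrow> polyhedron (closure K)"
  by (simp add: polygonal_cell_def polytope_imp_polyhedron)

lemma polygonal_cell_aff_dim: "polygonal_cell K \<Longrightarrow> aff_dim (closure K) = 2"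
  by (simp add: polygonal_cell_def closure_aff_dim aff_dim_open)

lemma edges_eq_facets: "polygonal_cell K \<Longrightarrow> edges K = {e. e facet_of closure K}"
  using polygonal_cell_aff_dim by (auto simp: edges_def edge_of_def facet_of_def)

lemma finite_edges: "polygonal_cell K \<Longrightarrow> finite (edges K)"
  unfolding edges_def edge_of_def polygonal_cell_def
  by (metis (no_types, lifting) Collect_mono finite_polytope_faces finite_subset)

lemma edge_is_segment:
  assumes "polygonal_cell K" and "e \<in> edges K"
  obtains a b where "e = closed_segment a b" and "a \<noteq> b"
proof -
  have e: "e face_of closure K" "aff_dim e = 1"
    using assms(2) by (auto simp: edges_def edge_of_def)
  have "polytope e" using e(1) assms(1) face_of_polytope_polytope
    unfolding polygonal_cell_def by blast
  then have "compact e" "convex e" by (auto simp: polytope_imp_compact polytope_imp_convex)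
  moreover have "e \<noteq> {}" using e(2) by auto
  moreover have "collinear e" using e(2) by (simp add: collinear_aff_dim)
  ultimately obtain a b where ab: "e = closed_segment a b"
    using compact_convex_collinear_segment by blast
  moreover have "a \<noteq> b" using ab e(2) by auto
  ultimately show ?thesis using that by blast
qed

lemma edge_subset_closure: "e \<in> edges K \<Longrightarrow> e \<subseteq> closure K"
  by (simp add: edges_def edge_of_imp_subset)

text \<open>Faces of polyhedra are exposed, so an edge is cut out by a supporting line. Openness of the cell makes
  the inequality strict inside.\<close>
lemma edge_supporting_line:
  assumes K: "polygonal_cell K" and e: "e \<in> edges K"
  obtains n b where "norm n = 1" and "\<And>y. y \<in> K \<Longrightarrow> n \<bullet> y < b"
    and "e = closure K \<inter> {x. n \<bullet> x = b}"
proof -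
  have face: "e face_of closure K" and dim: "aff_dim e = 1"
    using e by (auto simp: edges_def edge_of_def)
  have "e \<noteq> {}" and "e \<noteq> closure K"
    using dim polygonal_cell_aff_dim[OF K] by auto
  moreover have "e exposed_face_of closure K"
    using face exposed_face_of_polyhedron polygonal_cell_polyhedron[OF K] by blast
  ultimately obtain n b where n: "n \<noteq> 0" and le: "closure K \<subseteq> {x. n \<bullet> x \<le> b}"
    and eq: "e = closure K \<inter> {x. n \<bullet> x = b}"
    by (auto simp: exposed_face_of)
  have "K \<subseteq> interior {x. n \<bullet> x \<le> b}"
    using le closure_subset[of K] K by (intro interior_maximal) (auto simp: polygonal_cell_def)
  then have lt: "n \<bullet> y < b" if "y \<in> K" for y
    using that n by (auto simp: interior_halfspace_le)
  show ?thesis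
  proof
    show "norm (n /\<^sub>R norm n) = 1" using n by simp
    show "(n /\<^sub>R norm n) \<bullet> y < b / norm n" if "y \<in> K" for y
      using lt[OF that] n by (simp add: divide_simps)
    show "e = closure K \<inter> {x. (n /\<^sub>R norm n) \<bullet> x = b / norm n}"
      using eq n by (auto simp: divide_simps)
  qed
qed

text \<open>Each end of the edge lies in the closure of the cell, so both candidates are orthogonal to the edge;
  the cell lies on one side of it, which excludes opposite signs.\<close>
lemma outward_normal_unique:
  assumes K: "polygonal_cell K" and e: "e \<in> edges K"
    and n: "norm n = 1" "\<forall>x\<in>e. \<forall>y\<in>K. n \<bullet> (y - x) < 0"
    and n': "norm n' = 1" "\<forall>x\<in>e. \<forall>y\<in>K. n' \<bullet> (y - x) < 0"
  shows "n' = n"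
proof -
  obtain a b where ab: "e = closed_segment a b" "a \<noteq> b" using edge_is_segment[OF K e] .
  have orth: "m \<bullet> (b - a) = 0" if m: "\<forall>x\<in>e. \<forall>y\<in>K. m \<bullet> (y - x) < 0" for m
  proof -
    have "m \<bullet> (y - x) \<le> 0" if "x \<in> e" "y \<in> e" for x y
    proof -
      have "K \<subseteq> {y. m \<bullet> y \<le> m \<bullet> x}" using m \<open>x \<in> e\<close> by (force simp: inner_diff_right)
      then have "closure K \<subseteq> {y. m \<bullet> y \<le> m \<bullet> x}"
        by (rule closure_minimal) (rule closed_halfspace_le)
      then show ?thesis
        using \<open>y \<in> e\<close> edge_subset_closure[OF e] by (auto simp: inner_diff_right)
    qed
    from this[of a b] this[of b a] show ?thesis using ab by (simp add: inner_diff_right)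
  qed
  have "n' = n \<or> n' = - n"
    using unit_normals_agree_up_to_sign[OF n(1) orth n'(1) orth] n(2) n'(2) ab(2) by simp
  moreover obtain y where "y \<in> K" using K by (auto simp: polygonal_cell_def)
  moreover have "a \<in> e" using ab by simp
  ultimately show ?thesis using n(2) n'(2) by fastforce
qed

lemma outward_normal_char:
  assumes K: "polygonal_cell K" and e: "e \<in> edges K"
  shows norm_outward_normal: "norm (outward_normal K e) = 1"
    and outward_normal_neg: "\<And>x y. x \<in> e \<Longrightarrow> y \<in> K \<Longrightarrow> outward_normal K e \<bullet> (y - x) < 0"
    and edge_eq_line: "\<And>x. x \<in> e \<Longrightarrow> e = closure K \<inter> {y. outward_normal K e \<bullet> (y - x) = 0}"
proof -
  obtain n b where n: "norm n = 1" "\<And>y. y \<in> K \<Longrightarrow> n \<bullet> y < b"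
    and eq: "e = closure K \<inter> {x. n \<bullet> x = b}"
    using edge_supporting_line[OF K e] by metis
  have b: "n \<bullet> x = b" if "x \<in> e" for x using that eq by auto
  have neg: "\<forall>x\<in>e. \<forall>y\<in>K. n \<bullet> (y - x) < 0"
    using n(2) b by (auto simp: inner_diff_right)
  have on: "outward_normal K e = n"
    unfolding outward_normal_def
  proof (rule the_equality)
    show "norm n = 1 \<and> (\<forall>x\<in>e. \<forall>y\<in>K. n \<bullet> (y - x) < 0)" using n(1) neg by blast
    show "m = n" if "norm m = 1 \<and> (\<forall>x\<in>e. \<forall>y\<in>K. m \<bullet> (y - x) < 0)" for m
      using outward_normal_unique[OF K e n(1) neg] that by blast
  qed
  show "norm (outward_normal K e) = 1" unfolding on by (fact n(1))
  show "outward_normal K e \<bullet> (y - x) < 0" if "x \<in> e" "y \<in> K" for x y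
    unfolding on using neg that by blast
  show "e = closure K \<inter> {y. outward_normal K e \<bullet> (y - x) = 0}" if "x \<in> e" for x
    unfolding on inner_diff_right b[OF that] right_minus_eq by (fact eq)
qed

lemma outward_normal_nonpos:
  assumes K: "polygonal_cell K" and e: "e \<in> edges K" and x: "x \<in> e" and y: "y \<in> closure K"
  shows "outward_normal K e \<bullet> (y - x) \<le> 0"
proof -
  have "K \<subseteq> {y. outward_normal K e \<bullet> y \<le> outward_normal K e \<bullet> x}"
    using outward_normal_neg[OF K e x] by (force simp: inner_diff_right)
  then have "closure K \<subseteq> {y. outward_normal K e \<bullet> y \<le> outward_normal K e \<bullet> x}"
    by (rule closure_minimal) (rule closed_halfspace_le)
  then show ?thesis using y by (auto simp: inner_diff_right)
qed

lemma edge_length_closed_segment: "edge_length (closed_segment a b) = norm (b - a)"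
proof -
  have "diameter (closed_segment a b) = dist a b"
  proof (rule antisym)
    show "diameter (closed_segment a b) \<le> dist a b"
    proof (rule diameter_le)
      fix x y assume "x \<in> closed_segment a b" "y \<in> closed_segment a b"
      then obtain r s :: real where r: "0 \<le> r" "r \<le> 1" "x = (1 - r) *\<^sub>R a + r *\<^sub>R b"
        and s: "0 \<le> s" "s \<le> 1" "y = (1 - s) *\<^sub>R a + s *\<^sub>R b"
        by (auto simp: closed_segment_def)
      have "x - y = (r - s) *\<^sub>R (b - a)" unfolding r(3) s(3) by (simp add: algebra_simps)
      then have "norm (x - y) = \<bar>r - s\<bar> * dist a b" by (simp add: dist_norm norm_minus_commute)
      also have "\<dots> \<le> 1 * dist a b" using r s by (intro mult_right_mono) auto
      finally show "norm (x - y) \<le> dist a b" by simp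
    qed simp
    show "dist a b \<le> diameter (closed_segment a b)"
      by (rule diameter_bounded_bound) (auto simp: bounded_closed_segment)
  qed
  then show ?thesis by (simp add: edge_length_def dist_norm norm_minus_commute)
qed

section \<open>The boundary of a polygon is a closed chain\<close>

text \<open>The vector \<open>normal_of \<tau>\<close> points to the right of \<open>\<tau>\<close>. With the outward normal on the right, the edge is
  traversed from \<open>a\<close> to \<open>b\<close> with the cell on the left: this is the counterclockwise orientation of the
  boundary.\<close>
definition oriented_edge :: "cell \<Rightarrow> real^2 \<Rightarrow> real^2 \<Rightarrow> edge \<Rightarrow> bool" where
  "oriented_edge K a b e \<longleftrightarrow> e = closed_segment a b \<and> a \<noteq> b \<and>
     edge_length e *\<^sub>R outward_normal K e = normal_of (b - a)"

lemma oriented_edge_exists: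
  assumes K: "polygonal_cell K" and e: "e \<in> edges K"
  shows "\<exists>a b. oriented_edge K a b e"
proof -
  obtain a b where ab: "e = closed_segment a b" "a \<noteq> b" using edge_is_segment[OF K e] .
  let ?n = "outward_normal K e"
  have "b \<in> closure K \<inter> {y. ?n \<bullet> (y - a) = 0}"
    using edge_eq_line[OF K e, of a] ab by auto
  then have "?n \<bullet> (b - a) = 0" by simp
  then consider "norm (b - a) *\<^sub>R ?n = normal_of (b - a)" | "norm (b - a) *\<^sub>R ?n = - normal_of (b - a)"
    using unit_normal_cases[OF norm_outward_normal[OF K e], of "b - a"] ab(2) by auto
  then show ?thesis
  proof cases
    case 1
    then show ?thesis using ab by (auto simp: oriented_edge_def edge_length_closed_segment)
  next
    case 2
    have "- normal_of (b - a) = normal_of (a - b)"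
      by (simp add: linear_neg[OF linear_normal_of, symmetric])
    then have "oriented_edge K b a e"
      using 2 ab by (simp add: oriented_edge_def edge_length_closed_segment closed_segment_commute
          norm_minus_commute)
    then show ?thesis by blast
  qed
qed

text \<open>Let two edges leave \<open>v\<close> in directions \<open>p\<close> and \<open>q\<close> with the cell on the same side of both. Each edge lies
  in the supporting half-plane of the other, which gives the cross product of \<open>p\<close> and \<open>q\<close> both signs, by
  antisymmetry. So both edges lie on one line and are the same face. The sign \<open>s\<close> covers at once edges
  that start at \<open>v\<close> (\<open>s = 1\<close>) and edges that end there (\<open>s = -1\<close>, directions reversed).\<close>
lemma edges_same_normal_direction:
  assumes K: "polygonal_cell K" and e: "e \<in> edges K" and e': "e' \<in> edges K"
    and v: "v \<in> e" "v \<in> e'" and p: "v + p \<in> e" "p \<noteq> 0" and q: "v + q \<in> e'" "q \<noteq> 0"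
    and n: "r *\<^sub>R outward_normal K e = s *\<^sub>R normal_of p" "r > 0"
    and n': "r' *\<^sub>R outward_normal K e' = s *\<^sub>R normal_of q" "r' > 0"
    and s: "\<bar>s\<bar> = 1"
  shows "e = e'"
proof -
  have "outward_normal K e \<bullet> q \<le> 0"
    using outward_normal_nonpos[OF K e v(1)] edge_subset_closure[OF e'] q by force
  then have "r * (outward_normal K e \<bullet> q) \<le> 0"
    using n(2) by (simp add: mult_le_0_iff)
  then have le1: "s * (normal_of p \<bullet> q) \<le> 0"
    using n(1) by (metis inner_scaleR_left)
  have "outward_normal K e' \<bullet> p \<le> 0"
    using outward_normal_nonpos[OF K e' v(2)] edge_subset_closure[OF e] p by force
  then have "r' * (outward_normal K e' \<bullet> p) \<le> 0"
    using n'(2) by (simp add: mult_le_0_iff)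
  then have "s * (normal_of q \<bullet> p) \<le> 0"
    using n'(1) by (metis inner_scaleR_left)
  with le1 have "s * (normal_of p \<bullet> q) = 0" by (simp add: normal_of_antisym[of q p])
  then have cross: "normal_of p \<bullet> q = 0" using s by auto
  then have "r * (outward_normal K e \<bullet> q) = 0"
    using n(1) by (metis inner_scaleR_left mult_zero_right)
  then have perp: "outward_normal K e \<bullet> q = 0" using n(2) by simp
  have eq: "e = closure K \<inter> {y. outward_normal K e \<bullet> (y - v) = 0}"
    using edge_eq_line[OF K e v(1)] .
  have eq': "e' = closure K \<inter> {y. outward_normal K e' \<bullet> (y - v) = 0}"
    using edge_eq_line[OF K e' v(2)] .
  have "v + q \<in> closure K \<inter> {y. outward_normal K e' \<bullet> (y - v) = 0}" using eq' q by blast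
  then have perp': "outward_normal K e' \<bullet> q = 0" by simp
  have "outward_normal K e' = outward_normal K e \<or> outward_normal K e' = - outward_normal K e"
    using unit_normals_agree_up_to_sign norm_outward_normal[OF K e] norm_outward_normal[OF K e']
      perp perp' q(2) by blast
  moreover have "outward_normal K e' \<noteq> - outward_normal K e"
  proof
    assume opp: "outward_normal K e' = - outward_normal K e"
    obtain y where "y \<in> K" using K by (auto simp: polygonal_cell_def)
    then show False
      using outward_normal_neg[OF K e v(1), of y] outward_normal_neg[OF K e' v(2), of y] opp by simp
  qed
  ultimately show ?thesis using eq eq' by simp
qed

lemma oriented_edge_length_pos: "oriented_edge K a b e \<Longrightarrow> edge_length e > 0"
  by (auto simp: oriented_edge_def edge_length_closed_segment)

lemma oriented_edge_start_unique:
  assumes K: "polygonal_cell K" and e: "e \<in> edges K" and e': "e' \<in> edges K"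
    and o: "oriented_edge K a b e" "oriented_edge K a b' e'"
  shows "e = e'"
  using edges_same_normal_direction[OF K e e', of a "b - a" "b' - a" "edge_length e" 1 "edge_length e'"]
    o oriented_edge_length_pos[OF o(1)] oriented_edge_length_pos[OF o(2)]
  by (auto simp: oriented_edge_def)

lemma oriented_edge_end_unique:
  assumes K: "polygonal_cell K" and e: "e \<in> edges K" and e': "e' \<in> edges K"
    and o: "oriented_edge K a b e" "oriented_edge K a' b e'"
  shows "e = e'"
proof -
  have "- normal_of (a - b) = normal_of (b - a)" for a b
    by (simp add: linear_neg[OF linear_normal_of, symmetric])
  then show ?thesis
    using edges_same_normal_direction[OF K e e', of b "a - b" "a' - b" "edge_length e" "-1" "edge_length e'"]
      o oriented_edge_length_pos[OF o(1)] oriented_edge_length_pos[OF o(2)]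
    by (auto simp: oriented_edge_def)
qed

text \<open>A proper face of a polyhedron is the intersection of the facets containing it. A vertex has dimension
  0 and an edge dimension 1, so one edge is not enough.\<close>
lemma two_edges_at_vertex:
  assumes K: "polygonal_cell K" and v: "v extreme_point_of closure K"
  obtains e e' where "e \<in> edges K" "e' \<in> edges K" "e \<noteq> e'" "v \<in> e" "v \<in> e'"
proof -
  let ?F = "{F. F facet_of closure K \<and> {v} \<subseteq> F}"
  have face: "{v} face_of closure K" using v by (simp add: face_of_singleton)
  have ne: "{v} \<noteq> closure K" using polygonal_cell_aff_dim[OF K] by (metis aff_dim_sing zero_neq_numeral)
  have int: "{v} = \<Inter>?F"
    using face_of_polyhedron[OF polygonal_cell_polyhedron[OF K] face] ne by blast
  obtain e where e: "e facet_of closure K" "v \<in> e"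
    using face_of_polyhedron_subset_facet[OF polygonal_cell_polyhedron[OF K] face _ ne] by blast
  have "\<exists>e'\<in>?F. e' \<noteq> e"
  proof (rule ccontr)
    assume "\<not> (\<exists>e'\<in>?F. e' \<noteq> e)"
    moreover have "e \<in> ?F" using e by simp
    ultimately have "?F = {e}" by blast
    then have "{v} = e" using int unfolding \<open>?F = {e}\<close> by simp
    then have "aff_dim e = 0" by (metis aff_dim_sing)
    then show False using e(1) polygonal_cell_aff_dim[OF K] by (simp add: facet_of_def)
  qed
  then show ?thesis using e that edges_eq_facets[OF K] by auto
qed

text \<open>The divergence theorem for constant fields, obtained without integration. Up to a quarter turn
  \<open>\<bar>e\<bar> n\<^sub>e\<close> is the oriented edge vector \<open>b - a\<close>. No two edges start at the same vertex, no two end at the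
  same vertex, and each vertex lies on two edges; hence every vertex is the start of exactly one edge and
  the end of exactly one edge, and the sum of all \<open>b - a\<close> telescopes.\<close>
theorem sum_length_outward_normal:
  assumes K: "polygonal_cell K"
  shows "(\<Sum>e\<in>edges K. edge_length e *\<^sub>R outward_normal K e) = 0"
proof -
  obtain a b where ab: "\<And>e. e \<in> edges K \<Longrightarrow> oriented_edge K (a e) (b e) e"
    using oriented_edge_exists[OF K] by metis
  let ?V = "{v. v extreme_point_of closure K}"
  have vert: "v \<in> ?V \<and> v \<in> e \<longleftrightarrow> v = a e \<or> v = b e" if e: "e \<in> edges K" for e v
  proof -
    have "e face_of closure K" using e by (simp add: edges_def edge_of_def)
    then have "v \<in> ?V \<and> v \<in> e \<longleftrightarrow> v extreme_point_of e"
      using extreme_point_of_face by blast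
    moreover have "e = closed_segment (a e) (b e)" using ab[OF e] by (simp add: oriented_edge_def)
    ultimately show ?thesis using extreme_point_of_segment by metis
  qed
  have inja: "inj_on a (edges K)" and injb: "inj_on b (edges K)"
    using oriented_edge_start_unique[OF K] oriented_edge_end_unique[OF K] ab
    by (metis inj_onI)+
  have onto: "v \<in> a ` edges K \<and> v \<in> b ` edges K" if v: "v \<in> ?V" for v
  proof -
    obtain e e' where e: "e \<in> edges K" "e' \<in> edges K" "e \<noteq> e'" "v \<in> e" "v \<in> e'"
      using two_edges_at_vertex[OF K] v by blast
    then have "v = a e \<or> v = b e" "v = a e' \<or> v = b e'" using vert v by blast+
    moreover have "\<not> (v = a e \<and> v = a e')" "\<not> (v = b e \<and> v = b e')"
      using inja injb e by (metis inj_onD)+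
    ultimately show ?thesis using e by blast
  qed
  have "a ` edges K = ?V" "b ` edges K = ?V" using vert onto by blast+
  then have "(\<Sum>e\<in>edges K. a e) = (\<Sum>v\<in>?V. v)" "(\<Sum>e\<in>edges K. b e) = (\<Sum>v\<in>?V. v)"
    using sum.reindex[OF inja, of "\<lambda>v. v"] sum.reindex[OF injb, of "\<lambda>v. v"] by auto
  then have zero: "(\<Sum>e\<in>edges K. b e - a e) = 0" by (simp add: sum_subtractf)
  have "(\<Sum>e\<in>edges K. edge_length e *\<^sub>R outward_normal K e) = (\<Sum>e\<in>edges K. normal_of (b e - a e))"
    using ab by (intro sum.cong) (auto simp: oriented_edge_def)
  also have "\<dots> = normal_of (\<Sum>e\<in>edges K. b e - a e)"
    by (simp add: linear_sum[OF linear_normal_of])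
  finally show ?thesis using zero by (simp add: linear_0[OF linear_normal_of])
qed

section \<open>Two cells meet at an interior edge\<close>

text \<open>Close to an interior point of the common edge both cells fill the half-disc on their side. Explicitly,
  move a short way from the midpoint \<open>p\<close> towards a point \<open>y'\<close> of \<open>K'\<close>. This stays in \<open>K'\<close>; since the direction
  \<open>y' - p\<close> is a positive multiple of \<open>y - p\<close> up to a vector along the edge, the point reached also lies
  between another point of the edge and \<open>y\<close>, hence in \<open>K\<close>.\<close>
lemma cells_on_same_side_overlap:
  assumes K: "polygonal_cell K" "e \<in> edges K" and K': "polygonal_cell K'" "e \<in> edges K'"
    and same: "outward_normal K e = outward_normal K' e"
  shows "K \<inter> K' \<noteq> {}"
proof -
  let ?n = "outward_normal K e"
  obtain a b where ab: "e = closed_segment a b" "a \<noteq> b" using edge_is_segment[OF K] .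
  define d where "d = b - a"
  define p where "p = a + (1/2) *\<^sub>R d"
  have on: "p + r *\<^sub>R d \<in> e" if "\<bar>r\<bar> \<le> 1/2" for r
  proof -
    have "p + r *\<^sub>R d = (1 - (1/2 + r)) *\<^sub>R a + (1/2 + r) *\<^sub>R b"
      by (simp add: p_def d_def vec_eq_iff field_simps)
    moreover have "0 \<le> 1/2 + r" "1/2 + r \<le> 1" using that by linarith+
    ultimately show ?thesis unfolding ab(1) closed_segment_def by blast
  qed
  have pe: "p \<in> e" using on[of 0] by simp
  have nd: "?n \<bullet> d = 0"
    using edge_eq_line[OF K, of a] ab by (auto simp: d_def)
  have d0: "d \<noteq> 0" using ab by (simp add: d_def)
  obtain y y' where y: "y \<in> K" "y' \<in> K'" using K(1) K'(1) by (auto simp: polygonal_cell_def)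
  have neg: "?n \<bullet> (y - p) < 0" "?n \<bullet> (y' - p) < 0"
    using outward_normal_neg[OF K pe y(1)] outward_normal_neg[OF K' pe y(2)] same by auto
  define c where "c = (?n \<bullet> (y' - p)) / (?n \<bullet> (y - p))"
  have c: "c > 0" unfolding c_def using neg by (simp add: divide_neg_neg)
  define w where "w = (y' - p) - c *\<^sub>R (y - p)"
  have nw: "?n \<bullet> w = 0" unfolding w_def c_def using neg by (simp add: inner_diff_right)
  obtain s where s: "w = s *\<^sub>R d"
  proof -
    have "norm d *\<^sub>R ?n = normal_of d \<or> norm d *\<^sub>R ?n = - normal_of d"
      using unit_normal_cases[OF norm_outward_normal[OF K] nd d0] .
    then have "normal_of d \<bullet> w = 0" using nw
      by (metis inner_minus_left inner_scaleR_left mult_zero_right neg_equal_0_iff_equal)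
    then show ?thesis using parallel_to_tangent d0 that by blast
  qed
  \<comment> \<open>Small enough for the shifted base point \<open>p + r d\<close> to stay on the edge.\<close>
  define t where "t = 1 / (2 * (1 + c + \<bar>s\<bar>))"
  have pos: "1 + c + \<bar>s\<bar> > 0" using c by simp
  have t: "t > 0" "t < 1" "t * c < 1" "t * \<bar>s\<bar> \<le> 1/2 * (1 - t * c)"
    unfolding t_def using c pos by (simp_all add: field_simps)
  define r where "r = t * s / (1 - t * c)"
  have r: "\<bar>r\<bar> \<le> 1/2"
    unfolding r_def using t by (simp add: abs_mult divide_le_eq)
  define z where "z = p + t *\<^sub>R (y' - p)"
  have "(1 - t * c) *\<^sub>R (p + r *\<^sub>R d) = (1 - t * c) *\<^sub>R p + t *\<^sub>R w"
    using t(3) s by (simp add: r_def scaleR_add_right)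
  then have z: "z = (1 - t * c) *\<^sub>R (p + r *\<^sub>R d) + (t * c) *\<^sub>R y"
    unfolding z_def w_def by (simp add: algebra_simps)
  have cl: "x \<in> closure K" "x \<in> closure K'" if "x \<in> e" for x
    using that K K' edge_subset_closure by blast+
  have inside: "(1 - u) *\<^sub>R x + u *\<^sub>R y \<in> L"
    if L: "polygonal_cell L" "x \<in> closure L" "y \<in> L" "0 < u" "u < 1" for L x y and u :: real
  proof -
    have "open L" "convex L" using L(1) by (auto simp: polygonal_cell_def)
    have "x - u *\<^sub>R (x - y) \<in> interior L"
      using \<open>open L\<close> \<open>convex L\<close> L
      by (intro mem_interior_closure_convex_shrink) (auto simp: interior_open)
    then show ?thesis using \<open>open L\<close> by (simp add: interior_open algebra_simps)
  qed
  have "z \<in> K"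
    unfolding z using inside[OF K(1) cl(1)[OF on[OF r]] y(1), of "t * c"] t c by simp
  moreover have "z \<in> K'"
  proof -
    have "z = (1 - t) *\<^sub>R p + t *\<^sub>R y'" by (simp add: z_def algebra_simps)
    then show ?thesis using inside[OF K'(1) cl(2)[OF pe] y(2) t(1,2)] by simp
  qed
  ultimately show ?thesis by blast
qed

lemma outward_normals_of_common_edge:
  assumes K: "polygonal_cell K" "e \<in> edges K" and K': "polygonal_cell K'" "e \<in> edges K'"
  shows "outward_normal K' e = outward_normal K e \<or> outward_normal K' e = - outward_normal K e"
proof -
  obtain a b where ab: "e = closed_segment a b" "a \<noteq> b" using edge_is_segment[OF K] .
  have "b \<in> closure K \<inter> {y. outward_normal K e \<bullet> (y - a) = 0}"
    "b \<in> closure K' \<inter> {y. outward_normal K' e \<bullet> (y - a) = 0}"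
    using edge_eq_line[OF K, of a] edge_eq_line[OF K', of a] ab by auto
  then show ?thesis
    using unit_normals_agree_up_to_sign[OF norm_outward_normal[OF K] _ norm_outward_normal[OF K'], of "b - a"]
      ab(2) by auto
qed

text \<open>Of three distinct cells sharing an edge, two would have the same outward normal there and would
  overlap. So the choice in \<open>neighbour\<close> is between at most one candidate.\<close>
lemma neighbour_Some:
  assumes mesh: "conforming_mesh \<Omega> \<rho> N T" and K: "K \<in> T" "e \<in> edges K"
    and nb: "neighbour T K e = Some K'"
  shows "K' \<in> T \<and> e \<in> edges K'"
proof -
  have poly: "\<And>L. L \<in> T \<Longrightarrow> polygonal_cell L" and disj: "pairwise disjnt T"
    using mesh by (auto simp: conforming_mesh_def)
  let ?P = "\<lambda>L. L \<in> T \<and> L \<noteq> K \<and> e \<in> edges L"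
  have opp: "outward_normal L e = - outward_normal M e"
    if "L \<in> T" "M \<in> T" "L \<noteq> M" "e \<in> edges L" "e \<in> edges M" for L M
  proof -
    have "L \<inter> M = {}" using disj that unfolding pairwise_def disjnt_def by blast
    then show ?thesis
      using cells_on_same_side_overlap[of L e M] outward_normals_of_common_edge[of M e L] poly that
      by auto
  qed
  have uniq: "L = M" if L: "?P L" and M: "?P M" for L M
  proof (rule ccontr)
    assume "L \<noteq> M"
    then have "outward_normal L e = - outward_normal M e" using opp L M by blast
    moreover have "outward_normal L e = - outward_normal K e" "outward_normal M e = - outward_normal K e"
      using opp L M K by blast+
    ultimately have "outward_normal K e = 0" by (simp add: vec_eq_iff)
    then show False using norm_outward_normal[of K e] poly K by simp
  qed
  have ex: "\<exists>L. ?P L" and K': "K' = (THE L. ?P L)"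
    using nb unfolding neighbour_def the_cell_def by (auto split: if_splits)
  have "\<exists>!L. ?P L" using ex uniq by blast
  then have "?P (THE L. ?P L)" by (rule theI')
  then show ?thesis using K' by blast
qed


section \<open>One forward Euler step\<close>

lemma area_pos:
  assumes "polygonal_cell K"
  shows "area K > 0"
proof -
  have "open K" "K \<noteq> {}" "bounded (closure K)"
    using assms by (auto simp: polygonal_cell_def polytope_imp_bounded)
  have "bounded K" by (rule bounded_subset[OF \<open>bounded (closure K)\<close> closure_subset])
  then have "K \<in> lmeasurable" using \<open>open K\<close> by (rule lmeasurable_open)
  moreover have "\<not> negligible K" using \<open>open K\<close> \<open>K \<noteq> {}\<close> by (rule open_not_negligible)
  ultimately have "measure lebesgue K \<noteq> 0" using negligible_iff_measure by blast
  then show ?thesis unfolding area_def using measure_nonneg[of lebesgue K] by linarith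
qed

lemma edge_length_pos:
  assumes "polygonal_cell K" and "e \<in> edges K"
  shows "edge_length e > 0"
  using oriented_edge_exists[OF assms] oriented_edge_length_pos by blast

lemma mu_bounds:
  assumes K: "polygonal_cell K" and e: "e \<in> edges K" and lam: "\<forall>e\<in>edges K. 0 < lam D K e"
  shows "0 < mu D K" and "mu D K * edge_length e \<le> lam D K e * area K"
proof -
  let ?M = "(\<lambda>e. lam D K e * area K / edge_length e) ` edges K"
  have fin: "finite ?M" using finite_edges[OF K] by simp
  have "\<forall>x\<in>?M. 0 < x" using lam area_pos[OF K] edge_length_pos[OF K] by auto
  then show "0 < mu D K" unfolding mu_def using fin e by (subst Min_gr_iff) auto
  have "mu D K \<le> lam D K e * area K / edge_length e"
    unfolding mu_def using fin e by (intro Min_le) auto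
  then show "mu D K * edge_length e \<le> lam D K e * area K"
    using edge_length_pos[OF K e] by (simp add: pos_le_divide_eq)
qed

text \<open>For a cell of zero speed the quotient in the CFL condition is infinite, and the bound holds trivially.\<close>
lemma cfl_cell_bound:
  assumes cfl: "cfl_condition D G wspeed uh \<Delta>t" and K: "K \<in> cells D"
    and mu: "0 < mu D K" and S: "0 \<le> cell_speed D G wspeed uh K"
  shows "\<Delta>t * cell_speed D G wspeed uh K \<le> mu D K / 2"
proof (cases "cell_speed D G wspeed uh K = 0")
  case True
  then show ?thesis using mu by simp
next
  case False
  let ?S = "cell_speed D G wspeed uh K"
  have "ereal \<Delta>t \<le> ereal (mu D K) / ereal (2 * ?S)"
    using cfl INF_lower[OF K] order_trans unfolding cfl_condition_def by blast
  then have "\<Delta>t \<le> mu D K / (2 * ?S)" using False by simp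
  then show ?thesis using False S by (simp add: pos_le_divide_eq mult.assoc mult.left_commute field_simps)
qed

lemma wspeed_le_cell_speed:
  assumes "polygonal_cell K" and "e \<in> edges K" and "\<nu> \<in> {1..nq D}"
  shows "wspeed (inner_trace D G uh K e \<nu>) (outward_normal K e) \<le> cell_speed D G wspeed uh K"
proof -
  let ?w = "\<lambda>(e, \<nu>). wspeed (inner_trace D G uh K e \<nu>) (outward_normal K e)"
  have eq: "{wspeed (inner_trace D G uh K e \<nu>) (outward_normal K e) |e \<nu>. e \<in> edges K \<and> \<nu> \<in> {1..nq D}}
          = ?w ` (edges K \<times> {1..nq D})"
    by force
  have "?w (e, \<nu>) \<le> Max (?w ` (edges K \<times> {1..nq D}))"
    using finite_edges[OF assms(1)] assms(2,3) by (intro Max_ge finite_imageI imageI) auto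
  then show ?thesis unfolding cell_speed_def eq by simp
qed

text \<open>If interior weights are present, the remaining point \<open>u\<^sub>0\<close> is the one that \<open>G_admissible\<close> puts into \<open>G\<close>. If
  the edge weights exhaust the average, exactness applies to the unlimited reconstruction: its average is
  the weighted mean of its edge traces. Limiting moves all traces towards that very average by the same
  factor, so the mean is unchanged. In this case \<open>u\<^sub>0\<close> has weight 0.\<close>
lemma average_from_traces:
  fixes D :: "'m::finite discretization"
  assumes K: "K \<in> cells D"
    and recon: "reconstruction D" and quad: "edge_quadrature D"
    and cad: "cell_average_decomposition D" and bdry: "boundary_only_decomposition_exact D"
    and adm: "G_admissible D G K (limited_recon D G uh K) (fst uh K)"
  obtains u\<^sub>0 where "lam_sum D K \<le> 1" and "lam_sum D K < 1 \<Longrightarrow> u\<^sub>0 \<in> G"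
    and "fst uh K = (\<Sum>e\<in>edges K. lam D K e *\<^sub>R
                       (\<Sum>\<nu>=1..nq D. qweight D e \<nu> *\<^sub>R inner_trace D G uh K e \<nu>))
                    + (1 - lam_sum D K) *\<^sub>R u\<^sub>0"
proof -
  let ?m = "fst uh K" and ?u = "recon D K uh"
  let ?R = "\<Sum>e\<in>edges K. lam D K e *\<^sub>R
              (\<Sum>\<nu>=1..nq D. qweight D e \<nu> *\<^sub>R inner_trace D G uh K e \<nu>)"
  have beta: "\<forall>s\<in>{1..nint D K}. 0 < beta D K s"
    and one: "lam_sum D K + (\<Sum>s=1..nint D K. beta D K s) = 1"
    using cad K unfolding cell_average_decomposition_def by blast+
  have "0 \<le> (\<Sum>s=1..nint D K. beta D K s)" using beta by (intro sum_nonneg) (simp add: less_imp_le)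
  then have le: "lam_sum D K \<le> 1" using one by linarith
  show ?thesis
  proof (cases "lam_sum D K < 1")
    case True
    define u\<^sub>0 where "u\<^sub>0 = (1 / (1 - lam_sum D K)) *\<^sub>R (?m - ?R)"
    have "u\<^sub>0 \<in> G"
      using adm True unfolding G_admissible_def u\<^sub>0_def inner_trace_def by blast
    moreover have "?m = ?R + (1 - lam_sum D K) *\<^sub>R u\<^sub>0"
      using True by (simp add: u\<^sub>0_def)
    ultimately show ?thesis using that le by blast
  next
    case False
    then have full: "lam_sum D K = 1" using le by simp
    then have "\<not> 0 < (\<Sum>s=1..nint D K. beta D K s)" using one by simp
    then have none: "{1..nint D K} = {}" using beta sum_pos[of "{1..nint D K}" "beta D K"] by blast
    have uW: "?u \<in> wspace D K" and mean: "cell_mean K ?u = ?m"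
      using recon K unfolding reconstruction_def by blast+
    have w1: "(\<Sum>\<nu>=1..nq D. qweight D e \<nu>) = 1"
      and exact: "edge_mean e ?u = (\<Sum>\<nu>=1..nq D. qweight D e \<nu> *\<^sub>R ?u (qnode D e \<nu>))"
      if "e \<in> edges K" for e
      using quad K that uW unfolding edge_quadrature_def by blast+
    have "cad_exact_on D K (wspace D K)"
      using bdry K full unfolding boundary_only_decomposition_exact_def by blast
    then have "?m = (\<Sum>e\<in>edges K. lam D K e *\<^sub>R edge_mean e ?u)"
      using uW mean none unfolding cad_exact_on_def by simp
    then have m: "?m = (\<Sum>e\<in>edges K. lam D K e *\<^sub>R
                    (\<Sum>\<nu>=1..nq D. qweight D e \<nu> *\<^sub>R ?u (qnode D e \<nu>)))"
      using exact by simp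
    define \<theta> where "\<theta> = Sup {\<theta>\<in>{0..1}. theta_feasible D G K ?u ?m \<theta>}"
    have trace: "inner_trace D G uh K e \<nu> = (1 - \<theta>) *\<^sub>R ?m + \<theta> *\<^sub>R ?u (qnode D e \<nu>)" for e \<nu>
      by (simp add: inner_trace_def limited_recon_def limited_def scaled_def \<theta>_def algebra_simps)
    define X where "X e = (\<Sum>\<nu>=1..nq D. qweight D e \<nu> *\<^sub>R ?u (qnode D e \<nu>))" for e
    have "(\<Sum>\<nu>=1..nq D. qweight D e \<nu> *\<^sub>R inner_trace D G uh K e \<nu>) = (1 - \<theta>) *\<^sub>R ?m + \<theta> *\<^sub>R X e"
      if "e \<in> edges K" for e
    proof -
      have "(\<Sum>\<nu>=1..nq D. qweight D e \<nu> *\<^sub>R inner_trace D G uh K e \<nu>)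
              = (\<Sum>\<nu>=1..nq D. qweight D e \<nu>) *\<^sub>R ((1 - \<theta>) *\<^sub>R ?m)
                + \<theta> *\<^sub>R (\<Sum>\<nu>=1..nq D. qweight D e \<nu> *\<^sub>R ?u (qnode D e \<nu>))"
        unfolding trace scaleR_sum_left scaleR_sum_right sum.distrib[symmetric]
        by (intro sum.cong) (simp_all add: scaleR_add_right mult.commute)
      then show ?thesis using w1[OF that] by (simp add: X_def)
    qed
    then have "?R = (\<Sum>e\<in>edges K. lam D K e *\<^sub>R ((1 - \<theta>) *\<^sub>R ?m + \<theta> *\<^sub>R X e))"
      by simp
    also have "\<dots> = lam_sum D K *\<^sub>R ((1 - \<theta>) *\<^sub>R ?m) + \<theta> *\<^sub>R (\<Sum>e\<in>edges K. lam D K e *\<^sub>R X e)"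
      unfolding lam_sum_def scaleR_sum_left scaleR_sum_right sum.distrib[symmetric]
      by (intro sum.cong) (simp_all add: scaleR_add_right mult.commute)
    also have "\<dots> = ?m" using m full by (simp add: X_def algebra_simps)
    finally have "?m = ?R + (1 - lam_sum D K) *\<^sub>R 0" by simp
    then show ?thesis using that[of 0] le False by blast
  qed
qed

text \<open>The balance over one cell, tested against one half-space: \<open>L\<close> stands for its affine function at the
  interior traces, \<open>H\<close> for the flux in its direction, \<open>z\<close> for \<open>\<zeta> \<bullet> n\<close> and \<open>c\<close> for \<open>\<Delta>t / \<bar>K\<bar>\<close>.\<close>
lemma weighted_flux_bound:
  fixes \<omega> L H k :: "'e \<Rightarrow> nat \<Rightarrow> real" and len l z :: "'e \<Rightarrow> real"
  assumes \<omega>: "\<And>e \<nu>. e \<in> E \<Longrightarrow> \<nu> \<in> I \<Longrightarrow> 0 \<le> \<omega> e \<nu>"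
    and one: "\<And>e. e \<in> E \<Longrightarrow> (\<Sum>\<nu>\<in>I. \<omega> e \<nu>) = 1"
    and L: "\<And>e \<nu>. e \<in> E \<Longrightarrow> \<nu> \<in> I \<Longrightarrow> 0 \<le> L e \<nu>"
    and H: "\<And>e \<nu>. e \<in> E \<Longrightarrow> \<nu> \<in> I \<Longrightarrow> H e \<nu> \<le> k e \<nu> * L e \<nu> - z e"
    and step: "\<And>e \<nu>. e \<in> E \<Longrightarrow> \<nu> \<in> I \<Longrightarrow> c * len e * k e \<nu> \<le> l e"
    and c: "0 \<le> c" and len: "\<And>e. e \<in> E \<Longrightarrow> 0 \<le> len e"
    and closed: "(\<Sum>e\<in>E. len e * z e) = 0"
  shows "c * (\<Sum>e\<in>E. len e * (\<Sum>\<nu>\<in>I. \<omega> e \<nu> * H e \<nu>)) \<le> (\<Sum>e\<in>E. l e * (\<Sum>\<nu>\<in>I. \<omega> e \<nu> * L e \<nu>))"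
proof -
  have edge: "c * (len e * (\<Sum>\<nu>\<in>I. \<omega> e \<nu> * H e \<nu>)) \<le> l e * (\<Sum>\<nu>\<in>I. \<omega> e \<nu> * L e \<nu>) - c * (len e * z e)"
    if e: "e \<in> E" for e
  proof -
    have "c * len e * (\<omega> e \<nu> * H e \<nu>) \<le> l e * (\<omega> e \<nu> * L e \<nu>) - c * len e * (\<omega> e \<nu> * z e)"
      if \<nu>: "\<nu> \<in> I" for \<nu>
    proof -
      have "c * len e * H e \<nu> \<le> c * len e * (k e \<nu> * L e \<nu> - z e)"
        using H[OF e \<nu>] c len[OF e] by (intro mult_left_mono) auto
      also have "\<dots> = (c * len e * k e \<nu>) * L e \<nu> - c * len e * z e" by (simp add: algebra_simps)
      also have "\<dots> \<le> l e * L e \<nu> - c * len e * z e"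
        using mult_right_mono[OF step[OF e \<nu>] L[OF e \<nu>]] by simp
      finally have "\<omega> e \<nu> * (c * len e * H e \<nu>) \<le> \<omega> e \<nu> * (l e * L e \<nu> - c * len e * z e)"
        using \<omega>[OF e \<nu>] by (rule mult_left_mono)
      then show ?thesis by (simp add: algebra_simps)
    qed
    then have "(\<Sum>\<nu>\<in>I. c * len e * (\<omega> e \<nu> * H e \<nu>))
                 \<le> (\<Sum>\<nu>\<in>I. l e * (\<omega> e \<nu> * L e \<nu>) - c * len e * (\<omega> e \<nu> * z e))"
      by (rule sum_mono)
    also have "\<dots> = l e * (\<Sum>\<nu>\<in>I. \<omega> e \<nu> * L e \<nu>) - c * len e * ((\<Sum>\<nu>\<in>I. \<omega> e \<nu>) * z e)"
      by (simp add: sum_subtractf sum_distrib_left sum_distrib_right)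
    finally show ?thesis using one[OF e] by (simp add: sum_distrib_left mult.assoc)
  qed
  have "c * (\<Sum>e\<in>E. len e * (\<Sum>\<nu>\<in>I. \<omega> e \<nu> * H e \<nu>))
          = (\<Sum>e\<in>E. c * (len e * (\<Sum>\<nu>\<in>I. \<omega> e \<nu> * H e \<nu>)))"
    by (rule sum_distrib_left)
  also have "\<dots> \<le> (\<Sum>e\<in>E. l e * (\<Sum>\<nu>\<in>I. \<omega> e \<nu> * L e \<nu>) - c * (len e * z e))"
    using edge by (rule sum_mono)
  also have "\<dots> = (\<Sum>e\<in>E. l e * (\<Sum>\<nu>\<in>I. \<omega> e \<nu> * L e \<nu>)) - c * (\<Sum>e\<in>E. len e * z e)"
    by (simp only: sum_subtractf sum_distrib_left)
  finally show ?thesis using closed by simp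
qed

lemma inner_trace_in_domain:
  assumes "G_admissible D G K (limited_recon D G uh K) (fst uh K)"
    and "e \<in> edges K" and "\<nu> \<in> {1..nq D}"
  shows "inner_trace D G uh K e \<nu> \<in> G"
  using assms unfolding G_admissible_def inner_trace_def by blast

lemma outer_trace_in_domain:
  assumes mesh: "conforming_mesh \<Omega> \<rho> N (cells D)" and bc: "boundary_conditions D P G\<^sub>0 G"
    and adm: "\<forall>K\<in>cells D. G_admissible D G K (limited_recon D G uh K) (fst uh K)"
    and K: "K \<in> cells D" and e: "e \<in> edges K" and \<nu>: "\<nu> \<in> {1..nq D}"
  shows "outer_trace D P G uh K e \<nu> \<in> G"
proof (cases "neighbour (cells D) K e")
  case None
  then have "bstate P e \<nu> v A \<in> G" if "v \<in> G" for v A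
    using bc K e \<nu> that unfolding boundary_conditions_def by blast
  then show ?thesis
    using None inner_trace_in_domain[of D G K uh e \<nu>] adm K e \<nu> by (simp add: outer_trace_def)
next
  case (Some K')
  then have "K' \<in> cells D" "e \<in> edges K'" using neighbour_Some[OF mesh K e] by auto
  then show ?thesis
    using Some inner_trace_in_domain[of D G K' uh e \<nu>] adm \<nu> by (simp add: outer_trace_def)
qed

text \<open>The two splitting inequalities are used with different parameters: the speed \<open>s\<close> of the cell for the
  interior state, and the flux viscosity \<open>\<alpha>\<close> for the exterior state, whose contribution then cancels against
  the viscous term. This is why the viscosity must dominate the exterior speed.\<close>
lemma LF_flux_bound:
  assumes split: "weak_LF_splitting f J g G wspeed \<zeta>" and j: "j \<in> J" and v: "v \<in> touching g G j"
    and n: "norm n = 1" and ui: "ui \<in> G" and uo: "uo \<in> G"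
    and s: "wspeed ui n \<le> s" and \<alpha>: "wspeed uo n \<le> \<alpha>"
  shows "((1/2) *\<^sub>R (normal_flux f ui n + normal_flux f uo n) - (\<alpha> / 2) *\<^sub>R (uo - ui)) \<bullet> grad (g j) v
           \<le> ((s + \<alpha>) / 2) * ((ui - v) \<bullet> grad (g j) v) - \<zeta> j v \<bullet> n"
proof -
  let ?w = "grad (g j) v"
  have i: "s * ((ui - v) \<bullet> ?w) - normal_flux f ui n \<bullet> ?w \<ge> \<zeta> j v \<bullet> n"
    and o: "\<alpha> * ((uo - v) \<bullet> ?w) - normal_flux f uo n \<bullet> ?w \<ge> \<zeta> j v \<bullet> n"
    using split j v n ui uo s \<alpha> unfolding weak_LF_splitting_def by blast+
  have "((1/2) *\<^sub>R (normal_flux f ui n + normal_flux f uo n) - (\<alpha> / 2) *\<^sub>R (uo - ui)) \<bullet> ?w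
          = (normal_flux f ui n \<bullet> ?w + normal_flux f uo n \<bullet> ?w) / 2
            - (\<alpha> * ((uo - v) \<bullet> ?w) - \<alpha> * ((ui - v) \<bullet> ?w)) / 2"
    by (simp add: inner_add_left inner_diff_left algebra_simps diff_divide_distrib add_divide_distrib)
  also have "\<dots> \<le> (s * ((ui - v) \<bullet> ?w) + \<alpha> * ((ui - v) \<bullet> ?w)) / 2 - \<zeta> j v \<bullet> n"
  proof -
    have avg: "(Fi + Fo) / 2 - (B - A) / 2 \<le> (C + A) / 2 - z"
      if "C - Fi \<ge> z" "B - Fo \<ge> z" for Fi Fo A B C z :: real
      using that by (simp add: field_simps)
    show ?thesis by (rule avg[OF i o])
  qed
  finally show ?thesis by (simp add: algebra_simps add_divide_distrib)
qed

theorem average_update_in_domain: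
  fixes D :: "'m::finite discretization"
  assumes mesh: "conforming_mesh \<Omega> \<rho> N (cells D)"
    and recon: "reconstruction D" and quad: "edge_quadrature D"
    and dom: "invariant_domain J g G\<^sub>0 G"
    and cad: "cell_average_decomposition D" and bdry: "boundary_only_decomposition_exact D"
    and split: "weak_LF_splitting f J g G wspeed \<zeta>"
    and bc: "boundary_conditions D P G\<^sub>0 G"
    and m: "fst uh K \<in> G"
    and adm: "\<forall>K\<in>cells D. G_admissible D G K (limited_recon D G uh K) (fst uh K)"
    and visc: "LF_viscosity D P G wspeed uh \<alpha>"
    and \<Delta>t: "0 < \<Delta>t" and cfl: "cfl_condition D G wspeed uh \<Delta>t"
    and compat: "viscosity_step_compatible D \<alpha> \<Delta>t"
    and K: "K \<in> cells D"
  shows "average_update f D P G \<alpha> \<Delta>t uh K \<in> G"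
proof -
  have poly: "polygonal_cell K" using mesh K by (auto simp: conforming_mesh_def)
  have "G \<noteq> {}" using m by auto
  note gql = geometric_quasilinearization[OF dom \<open>G \<noteq> {}\<close>]
  let ?E = "edges K" and ?I = "{1..nq D}"
  let ?ui = "inner_trace D G uh K" and ?uo = "outer_trace D P G uh K"
  let ?n = "outward_normal K" and ?S = "cell_speed D G wspeed uh K"
  have ui: "?ui e \<nu> \<in> G" and uo: "?uo e \<nu> \<in> G" if "e \<in> ?E" "\<nu> \<in> ?I" for e \<nu>
    using inner_trace_in_domain outer_trace_in_domain[OF mesh bc adm K] adm K that by blast+
  have lam: "\<forall>e\<in>?E. 0 < lam D K e"
    using cad K unfolding cell_average_decomposition_def by blast
  have wpos: "0 < qweight D e \<nu>" if "e \<in> ?E" "\<nu> \<in> ?I" for e \<nu>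
    using quad K that unfolding edge_quadrature_def by blast
  have wone: "(\<Sum>\<nu>\<in>?I. qweight D e \<nu>) = 1" if "e \<in> ?E" for e
    using quad K that unfolding edge_quadrature_def by blast
  obtain u\<^sub>0 where le: "lam_sum D K \<le> 1" and u0: "lam_sum D K < 1 \<Longrightarrow> u\<^sub>0 \<in> G"
    and avg: "fst uh K = (\<Sum>e\<in>?E. lam D K e *\<^sub>R (\<Sum>\<nu>\<in>?I. qweight D e \<nu> *\<^sub>R ?ui e \<nu>))
                        + (1 - lam_sum D K) *\<^sub>R u\<^sub>0"
    using average_from_traces[OF K recon quad cad bdry, of G uh] adm K by blast
  define \<Phi> where "\<Phi> e \<nu> = (1/2) *\<^sub>R (normal_flux f (?ui e \<nu>) (?n e) + normal_flux f (?uo e \<nu>) (?n e))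
                           - (\<alpha> K e \<nu> / 2) *\<^sub>R (?uo e \<nu> - ?ui e \<nu>)" for e \<nu>
  have upd: "average_update f D P G \<alpha> \<Delta>t uh K
      = fst uh K - (\<Delta>t / area K) *\<^sub>R (\<Sum>e\<in>?E. edge_length e *\<^sub>R (\<Sum>\<nu>\<in>?I. qweight D e \<nu> *\<^sub>R \<Phi> e \<nu>))"
    by (simp add: average_update_def \<Phi>_def Let_def)
  have speed: "wspeed (?ui e \<nu>) (?n e) \<le> ?S" if "e \<in> ?E" "\<nu> \<in> ?I" for e \<nu>
    using wspeed_le_cell_speed[OF poly that] .
  have \<alpha>: "wspeed (?uo e \<nu>) (?n e) \<le> \<alpha> K e \<nu>" if "e \<in> ?E" "\<nu> \<in> ?I" for e \<nu>
    using visc K that unfolding LF_viscosity_def by fastforce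
  have step: "\<Delta>t / area K * edge_length e * ((?S + \<alpha> K e \<nu>) / 2) \<le> lam D K e"
    if e: "e \<in> ?E" and \<nu>: "\<nu> \<in> ?I" for e \<nu>
  proof -
    note mu = mu_bounds[OF poly e lam]
    have "0 \<le> wspeed (?ui e \<nu>) (?n e)"
      using split ui[OF e \<nu>] norm_outward_normal[OF poly e] unfolding weak_LF_splitting_def by blast
    then have "\<Delta>t * ?S \<le> mu D K / 2"
      using cfl_cell_bound[OF cfl K mu(1)] speed[OF e \<nu>] by linarith
    moreover have "\<Delta>t * \<alpha> K e \<nu> \<le> 3 / 2 * mu D K"
      using compat K e \<nu> unfolding viscosity_step_compatible_def by blast
    \<comment> \<open>The constants \<open>1/2\<close> and \<open>3/2\<close> average to exactly 1.\<close>
    ultimately have "\<Delta>t * ((?S + \<alpha> K e \<nu>) / 2) \<le> mu D K" by (simp add: distrib_left)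
    then have "\<Delta>t * ((?S + \<alpha> K e \<nu>) / 2) * edge_length e \<le> mu D K * edge_length e"
      using edge_length_pos[OF poly e] by (intro mult_right_mono) auto
    also have "\<dots> \<le> lam D K e * area K" by (fact mu(2))
    finally show ?thesis using area_pos[OF poly] by (simp add: field_simps)
  qed
  show ?thesis
    unfolding gql
  proof (intro ballI)
    fix j v assume j: "j \<in> J" and v: "v \<in> touching g G j"
    let ?w = "grad (g j) v"
    have half: "0 \<le> (u - v) \<bullet> ?w" if "u \<in> G" for u using gql that j v by blast
    have "\<Delta>t / area K * (\<Sum>e\<in>?E. edge_length e * (\<Sum>\<nu>\<in>?I. qweight D e \<nu> * (\<Phi> e \<nu> \<bullet> ?w)))
            \<le> (\<Sum>e\<in>?E. lam D K e * (\<Sum>\<nu>\<in>?I. qweight D e \<nu> * ((?ui e \<nu> - v) \<bullet> ?w)))"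
    proof (rule weighted_flux_bound)
      fix e \<nu> assume e: "e \<in> ?E" and \<nu>: "\<nu> \<in> ?I"
      show "\<Phi> e \<nu> \<bullet> ?w \<le> (?S + \<alpha> K e \<nu>) / 2 * ((?ui e \<nu> - v) \<bullet> ?w) - \<zeta> j v \<bullet> ?n e"
        unfolding \<Phi>_def
        using LF_flux_bound[OF split j v norm_outward_normal[OF poly e] ui[OF e \<nu>] uo[OF e \<nu>]
            speed[OF e \<nu>] \<alpha>[OF e \<nu>]] .
      show "\<Delta>t / area K * edge_length e * ((?S + \<alpha> K e \<nu>) / 2) \<le> lam D K e" using step[OF e \<nu>] .
      show "0 \<le> qweight D e \<nu>" using wpos[OF e \<nu>] by simp
      show "0 \<le> (?ui e \<nu> - v) \<bullet> ?w" using half[OF ui[OF e \<nu>]] .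
    next
      fix e assume e: "e \<in> ?E"
      show "(\<Sum>\<nu>\<in>?I. qweight D e \<nu>) = 1" using wone[OF e] .
      show "0 \<le> edge_length e" using edge_length_pos[OF poly e] by simp
    next
      show "0 \<le> \<Delta>t / area K" using \<Delta>t area_pos[OF poly] by simp
      have "(\<Sum>e\<in>?E. edge_length e * (\<zeta> j v \<bullet> ?n e)) = \<zeta> j v \<bullet> (\<Sum>e\<in>?E. edge_length e *\<^sub>R ?n e)"
        by (simp add: inner_sum_right)
      then show "(\<Sum>e\<in>?E. edge_length e * (\<zeta> j v \<bullet> ?n e)) = 0"
        by (simp add: sum_length_outward_normal[OF poly])
    qed
    moreover have "(fst uh K - v) \<bullet> ?w
        = (\<Sum>e\<in>?E. lam D K e * (\<Sum>\<nu>\<in>?I. qweight D e \<nu> * ((?ui e \<nu> - v) \<bullet> ?w)))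
          + (1 - lam_sum D K) * ((u\<^sub>0 - v) \<bullet> ?w)"
    proof -
      have "(\<Sum>e\<in>?E. lam D K e * (\<Sum>\<nu>\<in>?I. qweight D e \<nu> * ((?ui e \<nu> - v) \<bullet> ?w)))
              = (\<Sum>e\<in>?E. lam D K e * ((\<Sum>\<nu>\<in>?I. qweight D e \<nu> *\<^sub>R ?ui e \<nu>) \<bullet> ?w - v \<bullet> ?w))"
        using wone by (intro sum.cong refl)
          (simp add: inner_diff_left right_diff_distrib sum_subtractf inner_sum_left
            flip: sum_distrib_right)
      also have "\<dots> = (\<Sum>e\<in>?E. lam D K e *\<^sub>R (\<Sum>\<nu>\<in>?I. qweight D e \<nu> *\<^sub>R ?ui e \<nu>)) \<bullet> ?w
                       - lam_sum D K * (v \<bullet> ?w)"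
        by (simp add: right_diff_distrib sum_subtractf inner_sum_left lam_sum_def sum_distrib_right)
      finally show ?thesis
        unfolding avg by (simp add: inner_add_left inner_diff_left algebra_simps)
    qed
    moreover have "0 \<le> (1 - lam_sum D K) * ((u\<^sub>0 - v) \<bullet> ?w)"
    proof (cases "lam_sum D K < 1")
      case True
      then show ?thesis using half[OF u0] by simp
    qed (use le in simp)
    moreover have "(average_update f D P G \<alpha> \<Delta>t uh K - v) \<bullet> ?w = (fst uh K - v) \<bullet> ?w
        - \<Delta>t / area K * (\<Sum>e\<in>?E. edge_length e * (\<Sum>\<nu>\<in>?I. qweight D e \<nu> * (\<Phi> e \<nu> \<bullet> ?w)))"
      unfolding upd by (simp add: inner_diff_left inner_sum_left)
    ultimately show "0 \<le> (average_update f D P G \<alpha> \<Delta>t uh K - v) \<bullet> ?w" by linarith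
  qed
qed

lemma point_update_in_domain:
  assumes "admissibility_transform G\<^sub>0 \<Psi>"
  shows "point_update f \<Psi> D P G\<^sub>0 \<Delta>t uh \<sigma> \<in> G\<^sub>0"
  unfolding point_update_def
  using assms by (intro inv_into_into) (simp add: admissibility_transform_def bij_betw_def)

theorem theorem2p8:
  fixes f :: "2 \<Rightarrow> real^'m \<Rightarrow> real^'m"
    and \<Omega> :: "(real^2) set" and \<rho> :: real and N :: nat
    and D :: "'m::finite discretization" and P :: "'m point_data"
    and J :: "'j set" and g :: "'j \<Rightarrow> real^'m \<Rightarrow> real" and G\<^sub>0 G :: "(real^'m) set"
    and wspeed :: "real^'m \<Rightarrow> real^2 \<Rightarrow> real" and \<zeta> :: "'j \<Rightarrow> real^'m \<Rightarrow> real^2"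
    and \<Psi> :: "real^'m \<Rightarrow> real^'m"
    and \<alpha> :: "cell \<Rightarrow> edge \<Rightarrow> nat \<Rightarrow> real" and \<Delta>t :: real
    and uh uh' :: "'m state"
  assumes "hyperbolic_on G\<^sub>0 f"
    and "0 < \<rho>" and "conforming_mesh \<Omega> \<rho> N (cells D)"
    and "reconstruction D" and "edge_quadrature D"
    and "invariant_domain J g G\<^sub>0 G"
    and "cell_average_decomposition D" and "boundary_only_decomposition_exact D"
    and "weak_LF_splitting f J g G wspeed \<zeta>"
    and "admissibility_transform G\<^sub>0 \<Psi>"
    and "node_geometry (cells D) P"
    and "point_viscosity f \<Psi> (cells D) P (snd uh)"
    and "boundary_conditions D P G\<^sub>0 G"
    and "hybrid_admissible D G\<^sub>0 G uh"
    and "\<forall>K\<in>cells D. G_admissible D G K (limited_recon D G uh K) (fst uh K)"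
    and "LF_viscosity D P G wspeed uh \<alpha>"
    and "\<forall>K\<in>cells D. fst uh' K = average_update f D P G \<alpha> \<Delta>t uh K"
    and "\<forall>\<sigma>\<in>nodes (cells D). snd uh' \<sigma> = point_update f \<Psi> D P G\<^sub>0 \<Delta>t uh \<sigma>"
    and "0 < \<Delta>t" and "cfl_condition D G wspeed uh \<Delta>t"
    and "viscosity_step_compatible D \<alpha> \<Delta>t"
  shows "hybrid_admissible D G\<^sub>0 G uh'"
proof -
  have "fst uh' K \<in> G" if "K \<in> cells D" for K
    using assms that average_update_in_domain[of \<Omega> \<rho> N D J g G\<^sub>0 G f wspeed \<zeta> P uh K \<alpha> \<Delta>t]
    unfolding hybrid_admissible_def by metis
  moreover have "snd uh' \<sigma> \<in> G\<^sub>0" if "\<sigma> \<in> nodes (cells D)" for \<sigma>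
    using assms(10,18) that point_update_in_domain by metis
  ultimately show ?thesis by (simp add: hybrid_admissible_def)
qed

end
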